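(* Let $X$ be a compact connected Riemann surface and let $q,z:X\to\mathbb P^1$ be nonconstant meromorphic maps with ramification divisors $R_q$ and $R_z$. As a meromorphic section of $\mathcal H:=\operatorname{Hom}(q^*T\mathbb P^1,z^*T\mathbb P^1)$, the relative differential morphism $\mathcal Z=Tz\circ(Tq)^{-1}$ satisfies $$\operatorname{Div}(\mathcal Z)=R_z-R_q .$$
   Context: $Tq:TX\to q^*T\mathbb P^1$ and $Tz:TX\to z^*T\mathbb P^1$ are the differentials of the maps, viewed as bundle morphisms. $R_q=\sum_{p}r_q(p)\,p$ and $R_z=\sum_p r_z(p)\,p$, where $r_q(p)$ and $r_z(p)$ are the vanishing orders at $p$ of $Tq$ and $Tz$ (as sections of $\operatorname{Hom}(TX,q^*T\mathbb P^1)$ and $\operatorname{Hom}(TX,z^*T\mathbb P^1)$). The morphism $\mathcal Z$ is defined on $X\setminus(\operatorname{supp}R_q\cup\operatorname{supp}R_z)$, where both $Tq$ and $Tz$ are isomorphisms, and extended meromorphically to $X$. $\operatorname{Div}$ denotes the divisor of a meromorphic section of a holomorphic line bundle (orders taken with respect to nowhere vanishing holomorphic local frames). *)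

theory Defs
  imports "HOL-Complex_Analysis.Complex_Analysis"
begin

section \<open>Riemann surfaces\<close>

text \<open>A chart is a pair of its domain and its coordinate function; values of the coordinate
  outside the domain carry no meaning.\<close>

type_synonym 'a chart = "'a set \<times> ('a \<Rightarrow> complex)"

definition chart_inv :: "'a chart \<Rightarrow> complex \<Rightarrow> 'a" where
  "chart_inv c = inv_into (fst c) (snd c)"

record 'a surface =
  topo :: "'a topology"
  atlas :: "'a chart set"

definition charts_at :: "'a surface \<Rightarrow> 'a \<Rightarrow> 'a chart set" where
  "charts_at X p = {c \<in> atlas X. p \<in> fst c}"

text \<open>Neither connectedness nor compactness is part of the definition. Second countability is
  not required; it is automatic in the compact case.\<close>

definition riemann_surface :: "'a surface \<Rightarrow> bool" where
  "riemann_surface X \<longleftrightarrow>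
     Hausdorff_space (topo X) \<and>
     (\<Union>c\<in>atlas X. fst c) = topspace (topo X) \<and>
     (\<forall>c\<in>atlas X. openin (topo X) (fst c) \<and> open (snd c ` fst c) \<and>
        homeomorphic_map (subtopology (topo X) (fst c)) (top_of_set (snd c ` fst c)) (snd c)) \<and>
     (\<forall>c\<in>atlas X. \<forall>d\<in>atlas X.
        (snd d \<circ> chart_inv c) holomorphic_on (snd c ` (fst c \<inter> fst d)))"

definition holomorphic_map :: "'a surface \<Rightarrow> 'b surface \<Rightarrow> ('a \<Rightarrow> 'b) \<Rightarrow> bool" where
  "holomorphic_map X Y f \<longleftrightarrow>
     continuous_map (topo X) (topo Y) f \<and>
     (\<forall>c\<in>atlas X. \<forall>d\<in>atlas Y.
        (snd d \<circ> f \<circ> chart_inv c) holomorphic_on (snd c ` (fst c \<inter> f -` fst d)))"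

definition holomorphic_fun_on :: "'a surface \<Rightarrow> 'a set \<Rightarrow> ('a \<Rightarrow> complex) \<Rightarrow> bool" where
  "holomorphic_fun_on X W f \<longleftrightarrow>
     (\<forall>c\<in>atlas X. (f \<circ> chart_inv c) holomorphic_on (snd c ` (fst c \<inter> W)))"

definition meromorphic_fun_on :: "'a surface \<Rightarrow> 'a set \<Rightarrow> ('a \<Rightarrow> complex) \<Rightarrow> bool" where
  "meromorphic_fun_on X W f \<longleftrightarrow>
     (\<forall>c\<in>atlas X. (f \<circ> chart_inv c) meromorphic_on (snd c ` (fst c \<inter> W)))"

text \<open>The projective line as the Riemann sphere \<open>\<complex> \<union> {\<infinity>}\<close>, where \<^term>\<open>None\<close> is the point at
  infinity, with the coordinates \<open>w\<close> and \<open>1 / w\<close>.\<close>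

definition chart_infinity :: "complex option \<Rightarrow> complex" where
  "chart_infinity = (\<lambda>x. case x of None \<Rightarrow> 0 | Some w \<Rightarrow> 1 / w)"

definition P1 :: "complex option surface" where
  "P1 = \<lparr> topo = Alexandroff_compactification euclidean,
          atlas = {(range Some, the),
                   (- {Some 0}, chart_infinity)} \<rparr>"


section \<open>Holomorphic line bundles\<close>

text \<open>A bundle is given by its fibres with their vector space operations, and by a family of local
  frames \<open>(U, e)\<close> that determines the holomorphic structure.\<close>

record ('a, 'v) line_bundle =
  fibre :: "'a \<Rightarrow> 'v set"
  vzero :: "'a \<Rightarrow> 'v"
  vadd :: "'a \<Rightarrow> 'v \<Rightarrow> 'v \<Rightarrow> 'v"
  vscale :: "'a \<Rightarrow> complex \<Rightarrow> 'v \<Rightarrow> 'v"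
  frames :: "('a set \<times> ('a \<Rightarrow> 'v)) set"

text \<open>The function \<open>a\<close> with \<open>s = a e\<close>.\<close>

definition coefficient :: "('a, 'v) line_bundle \<Rightarrow> ('a \<Rightarrow> 'v) \<Rightarrow> ('a \<Rightarrow> 'v) \<Rightarrow> 'a \<Rightarrow> complex" where
  "coefficient L e s p = (THE a. s p = vscale L p a (e p))"

text \<open>The fibrewise conditions say that \<open>a \<mapsto> a e(p)\<close> is a linear isomorphism from \<open>\<complex>\<close> to
  the fibre; the last condition makes the transition functions holomorphic.\<close>

definition holomorphic_line_bundle :: "'a surface \<Rightarrow> ('a, 'v) line_bundle \<Rightarrow> bool" where
  "holomorphic_line_bundle X L \<longleftrightarrow>
     (\<Union>(U, e)\<in>frames L. U) = topspace (topo X) \<and>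
     (\<forall>(U, e)\<in>frames L. openin (topo X) U \<and>
        (\<forall>p\<in>U. bij_betw (\<lambda>a. vscale L p a (e p)) UNIV (fibre L p) \<and>
           vzero L p = vscale L p 0 (e p) \<and> vscale L p 1 (e p) = e p \<and>
           (\<forall>a b. vadd L p (vscale L p a (e p)) (vscale L p b (e p)) = vscale L p (a + b) (e p)) \<and>
           (\<forall>a b. vscale L p a (vscale L p b (e p)) = vscale L p (a * b) (e p)))) \<and>
     (\<forall>(U, e)\<in>frames L. \<forall>(V, f)\<in>frames L. holomorphic_fun_on X (U \<inter> V) (coefficient L e f))"

definition holomorphic_section_on ::
    "'a surface \<Rightarrow> ('a, 'v) line_bundle \<Rightarrow> 'a set \<Rightarrow> ('a \<Rightarrow> 'v) \<Rightarrow> bool" where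
  "holomorphic_section_on X L W s \<longleftrightarrow>
     (\<forall>p\<in>W. s p \<in> fibre L p) \<and>
     (\<forall>(U, e)\<in>frames L. holomorphic_fun_on X (U \<inter> W) (coefficient L e s))"

definition holomorphic_frame_on ::
    "'a surface \<Rightarrow> ('a, 'v) line_bundle \<Rightarrow> 'a set \<Rightarrow> ('a \<Rightarrow> 'v) \<Rightarrow> bool" where
  "holomorphic_frame_on X L W e \<longleftrightarrow>
     openin (topo X) W \<and> holomorphic_section_on X L W e \<and> (\<forall>p\<in>W. e p \<noteq> vzero L p)"

text \<open>A holomorphic section off a closed discrete set \<open>S\<close> that is meromorphic at the points of \<open>S\<close>.
  The values of \<open>s\<close> on \<open>S\<close> are irrelevant.\<close>

definition meromorphic_section ::
    "'a surface \<Rightarrow> ('a, 'v) line_bundle \<Rightarrow> ('a \<Rightarrow> 'v) \<Rightarrow> bool" where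
  "meromorphic_section X L s \<longleftrightarrow>
     (\<exists>S \<subseteq> topspace (topo X). topo X derived_set_of S = {} \<and>
        holomorphic_section_on X L (topspace (topo X) - S) s) \<and>
     (\<forall>(U, e)\<in>frames L. meromorphic_fun_on X U (coefficient L e s))"

text \<open>The order is well defined because it depends neither on the local frame nor on the chart.
  Note that \<^term>\<open>zorder\<close> ignores the value of the function at the point itself.\<close>

definition section_order :: "'a surface \<Rightarrow> ('a, 'v) line_bundle \<Rightarrow> ('a \<Rightarrow> 'v) \<Rightarrow> 'a \<Rightarrow> int" where
  "section_order X L s p =
     (THE n. \<forall>W e. holomorphic_frame_on X L W e \<and> p \<in> W \<longrightarrow>
        (\<forall>c\<in>charts_at X p. zorder (coefficient L e s \<circ> chart_inv c) (snd c p) = n))"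

text \<open>The divisor \<open>\<Sum>\<^sub>p D(p) p\<close> is represented by the function \<open>D\<close>, set to 0 outside the surface.\<close>

type_synonym 'a divisor = "'a \<Rightarrow> int"

definition supp :: "'a divisor \<Rightarrow> 'a set" where
  "supp D = {p. D p \<noteq> 0}"

definition is_divisor :: "'a surface \<Rightarrow> 'a divisor \<Rightarrow> bool" where
  "is_divisor X D \<longleftrightarrow> supp D \<subseteq> topspace (topo X) \<and> finite (supp D)"

definition Div :: "'a surface \<Rightarrow> ('a, 'v) line_bundle \<Rightarrow> ('a \<Rightarrow> 'v) \<Rightarrow> 'a divisor" where
  "Div X L s = (\<lambda>p. if p \<in> topspace (topo X) then section_order X L s p else 0)"


section \<open>Tangent, pullback and Hom bundles\<close>

text \<open>A tangent vector at \<open>p\<close> is a family of components, one for each chart at \<open>p\<close>, obeying the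
  transformation law of tangent vectors; components for all other charts are set to 0.\<close>

type_synonym 'a tangent = "'a chart \<Rightarrow> complex"

definition tangent_space :: "'a surface \<Rightarrow> 'a \<Rightarrow> 'a tangent set" where
  "tangent_space X p =
     {v. (\<forall>c\<in>charts_at X p. \<forall>d\<in>charts_at X p.
            v d = deriv (snd d \<circ> chart_inv c) (snd c p) * v c) \<and>
         (\<forall>c. c \<notin> charts_at X p \<longrightarrow> v c = 0)}"

text \<open>The coordinate vector field \<open>\<partial>/\<partial>w\<close> of a chart with coordinate \<open>w\<close>.\<close>

definition coordinate_field :: "'a surface \<Rightarrow> 'a chart \<Rightarrow> 'a \<Rightarrow> 'a tangent" where
  "coordinate_field X c p =
     (\<lambda>d. if d \<in> charts_at X p then deriv (snd d \<circ> chart_inv c) (snd c p) else 0)"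

definition tangent_bundle :: "'a surface \<Rightarrow> ('a, 'a tangent) line_bundle" where
  "tangent_bundle X =
     \<lparr> fibre = tangent_space X,
       vzero = (\<lambda>p c. 0),
       vadd = (\<lambda>p v w c. v c + w c),
       vscale = (\<lambda>p a v c. a * v c),
       frames = {(fst c, coordinate_field X c) | c. c \<in> atlas X} \<rparr>"

definition pullback_bundle :: "'a surface \<Rightarrow> ('a \<Rightarrow> 'b) \<Rightarrow> ('b, 'v) line_bundle \<Rightarrow> ('a, 'v) line_bundle" where
  "pullback_bundle X f L =
     \<lparr> fibre = (\<lambda>p. fibre L (f p)),
       vzero = (\<lambda>p. vzero L (f p)),
       vadd = (\<lambda>p. vadd L (f p)),
       vscale = (\<lambda>p. vscale L (f p)),
       frames = {(topspace (topo X) \<inter> f -` U, e \<circ> f) | U e. (U, e) \<in> frames L} \<rparr>"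

text \<open>Linear maps between fibres are extensional functions. Local frames \<open>e\<close> of \<open>L\<close> and \<open>f\<close> of \<open>M\<close>
  induce the local frame \<open>a e \<mapsto> a f\<close> of the Hom bundle.\<close>

definition hom_bundle ::
    "('a, 'v) line_bundle \<Rightarrow> ('a, 'w) line_bundle \<Rightarrow> ('a, 'v \<Rightarrow> 'w) line_bundle" where
  "hom_bundle L M =
     \<lparr> fibre = (\<lambda>p. {h \<in> fibre L p \<rightarrow>\<^sub>E fibre M p.
           (\<forall>v\<in>fibre L p. \<forall>w\<in>fibre L p. h (vadd L p v w) = vadd M p (h v) (h w)) \<and>
           (\<forall>a. \<forall>v\<in>fibre L p. h (vscale L p a v) = vscale M p a (h v))}),
       vzero = (\<lambda>p. \<lambda>v\<in>fibre L p. vzero M p),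
       vadd = (\<lambda>p h k. \<lambda>v\<in>fibre L p. vadd M p (h v) (k v)),
       vscale = (\<lambda>p a h. \<lambda>v\<in>fibre L p. vscale M p a (h v)),
       frames = {(U \<inter> V, \<lambda>p. \<lambda>v\<in>fibre L p. vscale M p (THE a. v = vscale L p a (e p)) (f p))
                 | U e V f. (U, e) \<in> frames L \<and> (V, f) \<in> frames M} \<rparr>"


section \<open>Differentials and ramification\<close>

text \<open>The value does not depend on the chosen chart \<open>c\<close> at \<open>p\<close>, by the chain rule.\<close>

definition differential ::
    "'a surface \<Rightarrow> 'b surface \<Rightarrow> ('a \<Rightarrow> 'b) \<Rightarrow> 'a \<Rightarrow> 'a tangent \<Rightarrow> 'b tangent" where
  "differential X Y f p =
     (\<lambda>v\<in>tangent_space X p. \<lambda>d.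
        if d \<in> charts_at Y (f p)
        then let c = (SOME c. c \<in> charts_at X p)
             in deriv (snd d \<circ> f \<circ> chart_inv c) (snd c p) * v c
        else 0)"

definition ramification_divisor :: "'a surface \<Rightarrow> ('a \<Rightarrow> complex option) \<Rightarrow> 'a divisor" where
  "ramification_divisor X f =
     Div X (hom_bundle (tangent_bundle X) (pullback_bundle X f (tangent_bundle P1)))
           (differential X P1 f)"

definition relative_hom_bundle ::
    "'a surface \<Rightarrow> ('a \<Rightarrow> complex option) \<Rightarrow> ('a \<Rightarrow> complex option) \<Rightarrow>
     ('a, complex option tangent \<Rightarrow> complex option tangent) line_bundle" where
  "relative_hom_bundle X q z =
     hom_bundle (pullback_bundle X q (tangent_bundle P1)) (pullback_bundle X z (tangent_bundle P1))"

text \<open>\<open>Tz \<circ> (Tq)\<^sup>-\<^sup>1\<close>, defined off the supports of the two ramification divisors.\<close>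

definition relative_differential ::
    "'a surface \<Rightarrow> ('a \<Rightarrow> complex option) \<Rightarrow> ('a \<Rightarrow> complex option) \<Rightarrow> 'a \<Rightarrow>
     complex option tangent \<Rightarrow> complex option tangent" where
  "relative_differential X q z =
     (\<lambda>p\<in>topspace (topo X) - (supp (ramification_divisor X q) \<union> supp (ramification_divisor X z)).
        \<lambda>w\<in>tangent_space P1 (q p).
          differential X P1 z p (inv_into (tangent_space X p) (differential X P1 q p) w))"


section \<open>The projective line is a Riemann surface, and the bundles are line bundles\<close>

lemma surface_chart:
  assumes "riemann_surface X" "c \<in> atlas X"
  shows inj_chart: "inj_on (snd c) (fst c)"
    and open_chart_image: "openin (topo X) W \<Longrightarrow> open (snd c ` (fst c \<inter> W))"
    and openin_chart_dom: "openin (topo X) (fst c)"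
    and chart_dom_subset: "fst c \<subseteq> topspace (topo X)"
proof -
  have op: "openin (topo X) (fst c)" and o: "open (snd c ` fst c)"
    and h: "homeomorphic_map (subtopology (topo X) (fst c)) (top_of_set (snd c ` fst c)) (snd c)"
    using assms by (auto simp: riemann_surface_def)
  show 1: "openin (topo X) (fst c)" by fact
  show 2: "fst c \<subseteq> topspace (topo X)" using 1 by (rule openin_subset)
  have ts: "topspace (subtopology (topo X) (fst c)) = fst c" using 2 by auto
  show "inj_on (snd c) (fst c)" using h ts by (simp add: homeomorphic_map_def)
  show "open (snd c ` (fst c \<inter> W))" if "openin (topo X) W"
  proof -
    have "openin (subtopology (topo X) (fst c)) (fst c \<inter> W)"
      using that by (simp add: openin_subtopology_Int2)
    then have "openin (top_of_set (snd c ` fst c)) (snd c ` (fst c \<inter> W))"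
      using homeomorphic_map_openness[OF h, of "fst c \<inter> W"] ts by auto
    then show ?thesis using o by (meson openin_open_trans)
  qed
qed

lemma chart_inv_chart [simp]:
  "riemann_surface X \<Longrightarrow> c \<in> atlas X \<Longrightarrow> p \<in> fst c \<Longrightarrow> chart_inv c (snd c p) = p"
  by (simp add: chart_inv_def inv_into_f_f[OF inj_chart])

lemma holo_trans:
  assumes "riemann_surface X" "c \<in> atlas X" "d \<in> atlas X"
  shows "(snd d \<circ> chart_inv c) holomorphic_on (snd c ` (fst c \<inter> fst d))"
    "open (snd c ` (fst c \<inter> fst d))"
  using assms open_chart_image[OF assms(1,2)] openin_chart_dom[OF assms(1,3)]
  by (auto simp: riemann_surface_def)

lemma trans_deriv:
  assumes X: "riemann_surface X" and c: "c \<in> charts_at X p" and d: "d \<in> charts_at X p"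
    and e: "e \<in> charts_at X p"
  shows "deriv (snd e \<circ> chart_inv c) (snd c p) =
         deriv (snd e \<circ> chart_inv d) (snd d p) * deriv (snd d \<circ> chart_inv c) (snd c p)"
proof -
  have m: "c \<in> atlas X" "d \<in> atlas X" "e \<in> atlas X" "p \<in> fst c" "p \<in> fst d" "p \<in> fst e"
    using c d e by (auto simp: charts_at_def)
  let ?S = "snd c ` (fst c \<inter> (fst d \<inter> fst e))"
  have oS: "open ?S" using m by (intro open_chart_image[OF X]) (auto intro: openin_chart_dom[OF X])
  have pS: "snd c p \<in> ?S" using m by auto
  have eq: "(snd e \<circ> chart_inv c) x = ((snd e \<circ> chart_inv d) \<circ> (snd d \<circ> chart_inv c)) x" if "x \<in> ?S" for x
    using that m X by auto
  have "deriv (snd e \<circ> chart_inv c) (snd c p) = deriv ((snd e \<circ> chart_inv d) \<circ> (snd d \<circ> chart_inv c)) (snd c p)"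
    by (rule deriv_cong_ev) (use eq oS pS eventually_nhds in blast)+
  also have "\<dots> = deriv (snd e \<circ> chart_inv d) ((snd d \<circ> chart_inv c) (snd c p)) * deriv (snd d \<circ> chart_inv c) (snd c p)"
  proof (rule deriv_chain)
    show "(snd d \<circ> chart_inv c) field_differentiable at (snd c p)"
      using holo_trans[OF X m(1,2)] m by (intro holomorphic_on_imp_differentiable_at) auto
    show "(snd e \<circ> chart_inv d) field_differentiable at ((snd d \<circ> chart_inv c) (snd c p))"
      using holo_trans[OF X m(2,3)] m X by (intro holomorphic_on_imp_differentiable_at) auto
  qed
  finally show ?thesis using m X by simp
qed

lemma trans_deriv_self:
  assumes X: "riemann_surface X" and c: "c \<in> charts_at X p"
  shows "deriv (snd c \<circ> chart_inv c) (snd c p) = 1"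
proof -
  have m: "c \<in> atlas X" "p \<in> fst c" using c by (auto simp: charts_at_def)
  have o: "open (snd c ` fst c)" using holo_trans(2)[OF X m(1) m(1)] by simp
  have "deriv (snd c \<circ> chart_inv c) (snd c p) = deriv (\<lambda>x. x) (snd c p)"
    by (rule deriv_cong_ev) (use o m X in \<open>auto intro!: eventually_nhds[THEN iffD2] exI[of _ "snd c ` fst c"]\<close>)
  then show ?thesis by simp
qed

lemma coordinate_field_tangent:
  assumes X: "riemann_surface X" and c: "c \<in> charts_at X p"
  shows "coordinate_field X c p \<in> tangent_space X p" "coordinate_field X c p c = 1"
proof -
  show "coordinate_field X c p c = 1"
    using c trans_deriv_self[OF X c] by (simp add: coordinate_field_def)
  have "coordinate_field X c p e = deriv (snd e \<circ> chart_inv d) (snd d p) * coordinate_field X c p d"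
    if "d \<in> charts_at X p" "e \<in> charts_at X p" for d e
    unfolding coordinate_field_def using that by (simp only: if_True) (rule trans_deriv[OF X c that])
  then show "coordinate_field X c p \<in> tangent_space X p"
    unfolding tangent_space_def by (intro CollectI conjI ballI allI impI) (assumption | simp add: coordinate_field_def)+
qed

lemma tangent_spaceD:
  assumes "v \<in> tangent_space X p"
  shows "c \<in> charts_at X p \<Longrightarrow> d \<in> charts_at X p \<Longrightarrow>
           v d = deriv (snd d \<circ> chart_inv c) (snd c p) * v c"
    and "c \<notin> charts_at X p \<Longrightarrow> v c = 0"
  using assms unfolding tangent_space_def mem_Collect_eq by (blast, blast)

lemma tangent_expand:
  assumes "riemann_surface X" "c \<in> charts_at X p" "v \<in> tangent_space X p"
  shows "v = (\<lambda>d. v c * coordinate_field X c p d)"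
proof
  fix d
  show "v d = v c * coordinate_field X c p d"
  proof (cases "d \<in> charts_at X p")
    case True
    then have "v d = deriv (snd d \<circ> chart_inv c) (snd c p) * v c"
      by (rule tangent_spaceD(1)[OF assms(3,2)])
    then show ?thesis using True by (simp add: coordinate_field_def)
  next
    case False
    then have "v d = 0" by (rule tangent_spaceD(2)[OF assms(3)])
    then show ?thesis using False by (simp add: coordinate_field_def)
  qed
qed

lemma tangent_scale:
  "v \<in> tangent_space X p \<Longrightarrow> (\<lambda>d. a * v d) \<in> tangent_space X p"
proof -
  assume v: "v \<in> tangent_space X p"
  have "a * v d = deriv (snd d \<circ> chart_inv c) (snd c p) * (a * v c)"
    if "c \<in> charts_at X p" "d \<in> charts_at X p" for c d
  proof -
    have "v d = deriv (snd d \<circ> chart_inv c) (snd c p) * v c"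
      by (rule tangent_spaceD(1)[OF v that])
    then show ?thesis by (metis mult.left_commute)
  qed
  moreover have "a * v c = 0" if "c \<notin> charts_at X p" for c
    by (simp add: tangent_spaceD(2)[OF v that])
  ultimately show ?thesis
    unfolding tangent_space_def by (intro CollectI conjI ballI allI impI) assumption+
qed

lemma tangent_coefficient:
  assumes X: "riemann_surface X" "c \<in> charts_at X p" "s p \<in> tangent_space X p"
  shows "coefficient (tangent_bundle X) (coordinate_field X c) s p = s p c"
proof -
  have "s p = (\<lambda>d. s p c * coordinate_field X c p d)" by (rule tangent_expand[OF assms])
  have "a = s p c" if "s p = (\<lambda>d. a * coordinate_field X c p d)" for a
  proof -
    have "s p c = a * coordinate_field X c p c" by (rule fun_cong[OF that])
    then show ?thesis using coordinate_field_tangent(2)[OF X(1,2)] by (metis mult.right_neutral)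
  qed
  note 1 = this
  have "(THE a. s p = (\<lambda>d. a * coordinate_field X c p d)) = s p c"
    by (rule the_equality) (fact, rule 1)
  then show ?thesis by (simp add: coefficient_def tangent_bundle_def)
qed

lemma holomorphic_line_bundleI:
  assumes "(\<Union>c\<in>frames L. fst c) = topspace (topo X)"
    and "\<And>U e. (U, e) \<in> frames L \<Longrightarrow> openin (topo X) U"
    and "\<And>U e p. (U, e) \<in> frames L \<Longrightarrow> p \<in> U \<Longrightarrow>
           bij_betw (\<lambda>a. vscale L p a (e p)) UNIV (fibre L p)"
    and "\<And>U e p. (U, e) \<in> frames L \<Longrightarrow> p \<in> U \<Longrightarrow> vzero L p = vscale L p 0 (e p)"
    and "\<And>U e p. (U, e) \<in> frames L \<Longrightarrow> p \<in> U \<Longrightarrow> vscale L p 1 (e p) = e p"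
    and "\<And>U e p a b. (U, e) \<in> frames L \<Longrightarrow> p \<in> U \<Longrightarrow>
           vadd L p (vscale L p a (e p)) (vscale L p b (e p)) = vscale L p (a + b) (e p)"
    and "\<And>U e p a b. (U, e) \<in> frames L \<Longrightarrow> p \<in> U \<Longrightarrow>
           vscale L p a (vscale L p b (e p)) = vscale L p (a * b) (e p)"
    and "\<And>U e V f. (U, e) \<in> frames L \<Longrightarrow> (V, f) \<in> frames L \<Longrightarrow>
           holomorphic_fun_on X (U \<inter> V) (coefficient L e f)"
  shows "holomorphic_line_bundle X L"
proof -
  have m: "(fst c, snd c) \<in> frames L" if "c \<in> frames L" for c using that by simp
  show ?thesis
    unfolding holomorphic_line_bundle_def case_prod_unfold
    by (intro conjI ballI allI; (rule assms(1) | (rule assms(2-); (erule m | assumption))))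
qed

lemma holomorphic_line_bundleD:
  assumes "holomorphic_line_bundle X L"
  shows "(\<Union>c\<in>frames L. fst c) = topspace (topo X)"
    and "\<And>U e. (U, e) \<in> frames L \<Longrightarrow> openin (topo X) U"
    and "\<And>U e p. (U, e) \<in> frames L \<Longrightarrow> p \<in> U \<Longrightarrow>
           bij_betw (\<lambda>a. vscale L p a (e p)) UNIV (fibre L p)"
    and "\<And>U e p. (U, e) \<in> frames L \<Longrightarrow> p \<in> U \<Longrightarrow> vzero L p = vscale L p 0 (e p)"
    and "\<And>U e p. (U, e) \<in> frames L \<Longrightarrow> p \<in> U \<Longrightarrow> vscale L p 1 (e p) = e p"
    and "\<And>U e p a b. (U, e) \<in> frames L \<Longrightarrow> p \<in> U \<Longrightarrow>
           vadd L p (vscale L p a (e p)) (vscale L p b (e p)) = vscale L p (a + b) (e p)"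
    and "\<And>U e p a b. (U, e) \<in> frames L \<Longrightarrow> p \<in> U \<Longrightarrow>
           vscale L p a (vscale L p b (e p)) = vscale L p (a * b) (e p)"
    and "\<And>U e V f. (U, e) \<in> frames L \<Longrightarrow> (V, f) \<in> frames L \<Longrightarrow>
           holomorphic_fun_on X (U \<inter> V) (coefficient L e f)"
proof -
  note A = assms[unfolded holomorphic_line_bundle_def case_prod_unfold]
  show "(\<Union>c\<in>frames L. fst c) = topspace (topo X)" using A by (rule conjunct1)
  note B = A[THEN conjunct2, THEN conjunct1, THEN bspec, of "(U, e)" for U e, simplified fst_conv snd_conv]
  note C = A[THEN conjunct2, THEN conjunct2, THEN bspec, THEN bspec, of "(U, e)" "(V, f)" for U e V f, simplified fst_conv snd_conv]
  show "openin (topo X) U" if "(U, e) \<in> frames L" for U e using B[OF that] by blast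
  fix U e p a b assume Ue: "(U, e) \<in> frames L" and p: "p \<in> U"
  note D = bspec[OF conjunct2[OF B[OF Ue]] p]
  show "bij_betw (\<lambda>a. vscale L p a (e p)) UNIV (fibre L p)" using D by blast
  show "vzero L p = vscale L p 0 (e p)" using D by blast
  show "vscale L p 1 (e p) = e p" using D by blast
  show "vadd L p (vscale L p a (e p)) (vscale L p b (e p)) = vscale L p (a + b) (e p)" using D by blast
  show "vscale L p a (vscale L p b (e p)) = vscale L p (a * b) (e p)" using D by blast
next
  note A = assms[unfolded holomorphic_line_bundle_def case_prod_unfold]
  note C = A[THEN conjunct2, THEN conjunct2, THEN bspec, THEN bspec, of "(U, e)" "(V, f)" for U e V f, simplified fst_conv snd_conv]
  show "holomorphic_fun_on X (U \<inter> V) (coefficient L e f)"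
    if "(U, e) \<in> frames L" "(V, f) \<in> frames L" for U e V f using C[OF that] .
qed

lemma line_bundle_tangent_bundle:
  assumes X: "riemann_surface X"
  shows "holomorphic_line_bundle X (tangent_bundle X)"
proof (rule holomorphic_line_bundleI)
  let ?T = "tangent_bundle X"
  have fr: "frames ?T = (\<lambda>c. (fst c, coordinate_field X c)) ` atlas X" unfolding tangent_bundle_def line_bundle.simps by blast
  show "(\<Union>c\<in>frames ?T. fst c) = topspace (topo X)"
    using X by (simp add: fr image_image riemann_surface_def)
  fix U e assume "(U, e) \<in> frames ?T"
  then obtain c where c: "c \<in> atlas X" and Ue: "U = fst c" "e = coordinate_field X c" by (auto simp: fr)
  show "openin (topo X) U" unfolding Ue by (rule openin_chart_dom[OF X c])
  { fix V f assume "(V, f) \<in> frames ?T"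
    then obtain d where d: "d \<in> atlas X" and Vf: "V = fst d" "f = coordinate_field X d" by (auto simp: fr)
    show "holomorphic_fun_on X (U \<inter> V) (coefficient ?T e f)"
      unfolding holomorphic_fun_on_def
    proof
      fix b assume b: "b \<in> atlas X"
      let ?S = "snd b ` (fst b \<inter> (U \<inter> V))"
      have "(deriv (snd c \<circ> chart_inv d) \<circ> (snd d \<circ> chart_inv b)) holomorphic_on ?S"
      proof (rule holomorphic_on_compose_gen)
        show "(snd d \<circ> chart_inv b) holomorphic_on ?S"
          using holo_trans(1)[OF X b d] by (rule holomorphic_on_subset) (auto simp: Vf)
        show "deriv (snd c \<circ> chart_inv d) holomorphic_on (snd d ` (fst d \<inter> fst c))"
          using holo_trans[OF X d c] by (intro holomorphic_deriv) auto
        show "(snd d \<circ> chart_inv b) ` ?S \<subseteq> snd d ` (fst d \<inter> fst c)" using X b by (auto simp: Ue Vf)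
      qed
      then show "(coefficient ?T e f \<circ> chart_inv b) holomorphic_on ?S"
      proof (rule holomorphic_transform, goal_cases)
        case (1 x)
        then obtain p where p: "p \<in> fst b" "p \<in> fst c" "p \<in> fst d" "x = snd b p" by (auto simp: Ue Vf)
        have dc: "d \<in> charts_at X p" "c \<in> charts_at X p" using p c d by (auto simp: charts_at_def)
        have "coefficient ?T e f p = f p c"
          unfolding Ue Vf by (intro tangent_coefficient coordinate_field_tangent X dc)
        then show ?case using p b X dc by (simp add: Vf coordinate_field_def)
      qed
    qed }
  fix p assume "p \<in> U"
  then have cp: "c \<in> charts_at X p" using c by (auto simp: charts_at_def Ue)
  note t = coordinate_field_tangent[OF X cp, folded Ue]
  have "bij_betw (\<lambda>a d. a * e p d) UNIV (tangent_space X p)"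
  proof (rule bij_betw_byWitness[where f' = "\<lambda>v. v c"])
    show "\<forall>a\<in>UNIV. a * e p c = a" using t(2) by simp
    show "\<forall>v\<in>tangent_space X p. (\<lambda>d. v c * e p d) = v"
      unfolding Ue using tangent_expand[OF X cp] by metis
    show "range (\<lambda>a d. a * e p d) \<subseteq> tangent_space X p"
      using tangent_scale[OF t(1)] by blast
  qed simp
  then show "bij_betw (\<lambda>a. vscale ?T p a (e p)) UNIV (fibre ?T p)" by (simp add: tangent_bundle_def)
qed (simp_all add: tangent_bundle_def algebra_simps)

lemma chart_infinity_homeo:
  "homeomorphic_map (subtopology (Alexandroff_compactification euclidean) (- {Some 0}))
     (euclidean :: complex topology) chart_infinity"
proof -
  let ?A = "Alexandroff_compactification (euclidean :: complex topology)"
  have op: "openin ?A (- {Some 0})"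
  proof -
    have "- {Some (0::complex)} = insert None (Some ` (topspace euclidean - {0}))"
      by (auto simp: image_iff)
    then show ?thesis unfolding openin_Alexandroff_compactification by (intro disjI2 exI[of _ "{0}"]) simp
  qed
  have ts: "topspace (subtopology ?A (- {Some 0})) = - {Some 0}"
    using openin_subset[OF op] by auto
  have inj: "inj_on chart_infinity (- {Some 0})"
    by (auto simp: inj_on_def chart_infinity_def split: option.splits)
  have surj: "chart_infinity ` (- {Some 0}) = UNIV"
  proof -
    have "u \<in> chart_infinity ` (- {Some 0})" for u
    proof (cases "u = 0")
      case True then show ?thesis by (intro image_eqI[of _ _ None]) (auto simp: chart_infinity_def)
    next
      case False then show ?thesis by (intro image_eqI[of _ _ "Some (1/u)"]) (auto simp: chart_infinity_def)
    qed
    then show ?thesis by auto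
  qed
  have main: "openin ?A {x \<in> - {Some 0}. chart_infinity x \<in> U} \<longleftrightarrow> open U" for U
  proof -
    define V where "V = {w. w \<noteq> 0 \<and> 1 / w \<in> U}"
    have V1: "open V" if "open U"
    proof -
      have "V = (- {0}) \<inter> (\<lambda>w. 1/w) -` U" by (auto simp: V_def)
      moreover have "open ((- {0}) \<inter> (\<lambda>w::complex. 1/w) -` U)"
        by (intro continuous_open_preimage continuous_intros that) auto
      ultimately show ?thesis by simp
    qed
    have V2: "open (U - {0})" if "open V"
    proof -
      have "U - {0} = (- {0}) \<inter> (\<lambda>w. 1/w) -` V" by (auto simp: V_def)
      moreover have "open ((- {0}) \<inter> (\<lambda>w::complex. 1/w) -` V)"
        by (intro continuous_open_preimage continuous_intros that) auto
      ultimately show ?thesis by simp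
    qed
    show ?thesis
    proof (cases "0 \<in> U")
      case False
      have "{x \<in> - {Some 0}. chart_infinity x \<in> U} = Some ` V"
        using False by (auto simp: V_def chart_infinity_def split: option.splits)
      then show ?thesis using V1 V2 False by auto
    next
      case True
      have e: "{x \<in> - {Some 0}. chart_infinity x \<in> U} = insert None (Some ` V)"
        (is "?L = ?R")
      proof (rule set_eqI)
        fix x show "x \<in> ?L \<longleftrightarrow> x \<in> ?R"
          by (cases x) (use True in \<open>auto simp: V_def chart_infinity_def\<close>)
      qed
      have "openin ?A (insert None (Some ` V)) \<longleftrightarrow> compact (- V)"
      proof -
        have "openin ?A (insert None (Some ` V)) \<longleftrightarrow>
           (\<exists>C. compact C \<and> closed C \<and> insert None (Some ` V) = insert None (Some ` (UNIV - C)))"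
          by (auto simp: openin_Alexandroff_compactification)
        also have "\<dots> \<longleftrightarrow> (\<exists>C. compact C \<and> closed C \<and> V = - C)"
          by (metis Compl_eq_Diff_UNIV image_iff inj_Some inj_image_eq_iff insert_ident option.distinct(1))
        also have "\<dots> \<longleftrightarrow> compact (- V)" using compact_imp_closed by (metis double_complement)
        finally show ?thesis .
      qed
      also have "\<dots> \<longleftrightarrow> open U"
      proof
        assume c: "compact (- V)"
        then have "open V" using compact_imp_closed open_closed by blast
        then have 1: "open (U - {0})" by (rule V2)
        obtain R where R: "R > 0" "\<And>x. x \<in> - V \<Longrightarrow> norm x < R"
          using c by (meson bounded_pos_less compact_imp_bounded)
        have "ball 0 (1/R) \<subseteq> U"
        proof
          fix u :: complex assume "u \<in> ball 0 (1/R)"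
          then have u: "norm u < 1/R" by simp
          show "u \<in> U"
          proof (cases "u = 0")
            case False
            then have "norm (1/u) > R" using u R(1) by (simp add: norm_divide field_simps)
            then have "1/u \<in> V" using R(2) by force
            then show ?thesis by (simp add: V_def)
          qed (use True in simp)
        qed
        then have "U = (U - {0}) \<union> ball 0 (1/R)" using R(1) True by auto
        then show "open U" using 1 by (metis open_Un open_ball)
      next
        assume o: "open U"
        obtain r where r: "r > 0" "ball 0 r \<subseteq> U" using o True by (meson openE)
        have "closed (- V)" using V1[OF o] by (simp add: closed_Compl)
        moreover have "bounded (- V)"
        proof (rule boundedI)
          fix x assume x: "x \<in> - V"
          show "norm x \<le> 1/r"
          proof (rule ccontr)
            assume "\<not> ?thesis"
            then have l: "norm x > 1/r" by simp
            then have x0: "x \<noteq> 0" using r(1) by (metis divide_pos_pos norm_zero order_less_asym zero_less_one)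
            then have "norm (1/x) < r" using l r(1) by (simp add: norm_divide field_simps)
            then have "1/x \<in> U" using r(2) by auto
            then show False using x x0 by (auto simp: V_def)
          qed
        qed
        ultimately show "compact (- V)" by (simp add: compact_eq_bounded_closed)
      qed
      finally show ?thesis using e by simp
    qed
  qed
  show ?thesis
    unfolding homeomorphic_map_def quotient_map_def ts
    using inj surj main op by (auto simp: openin_open_subtopology)
qed

lemma riemann_surface_P1: "riemann_surface P1"
proof -
  let ?A = "Alexandroff_compactification (euclidean :: complex topology)"
  have H: "Hausdorff_space ?A"
    by (simp add: Hausdorff_space_Alexandroff_compactification Hausdorff_space_euclidean
        locally_compact_space_euclidean)
  have h: "homeomorphic_map (subtopology ?A (range Some)) euclidean the"
  proof -
    have "homeomorphic_map euclidean (subtopology ?A (range Some)) Some"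
      using embedding_map_Some[of "euclidean :: complex topology"] by (simp add: embedding_map_def)
    then obtain g where g: "homeomorphic_maps euclidean (subtopology ?A (range Some)) Some g"
      using homeomorphic_map_maps by blast
    then have "homeomorphic_map (subtopology ?A (range Some)) euclidean g"
      by (meson homeomorphic_map_maps homeomorphic_maps_sym)
    moreover have "g x = the x" if "x \<in> topspace (subtopology ?A (range Some))" for x
      using g that by (auto simp: homeomorphic_maps_def)
    ultimately show ?thesis by (rule homeomorphic_map_eq)
  qed
  have r1: "the ` range Some = (UNIV :: complex set)" by (auto simp: image_iff)
  have op: "openin ?A (- {Some 0})"
  proof -
    have "- {Some (0::complex)} = insert None (Some ` (topspace euclidean - {0}))"
      by (auto simp: image_iff)
    then show ?thesis unfolding openin_Alexandroff_compactification by (intro disjI2 exI[of _ "{0}"]) simp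
  qed
  have r2: "chart_infinity ` (- {Some 0}) = UNIV"
    using homeomorphic_imp_surjective_map[OF chart_infinity_homeo] openin_subset[OF op] by auto
  have P: "P1 = \<lparr> topo = ?A, atlas = {(range Some, the), (- {Some 0}, chart_infinity)} \<rparr>"
    by (simp add: P1_def)
  have i1: "inv_into (range Some) the w = Some w" for w :: complex
    by (rule inv_into_f_eq) (auto simp: inj_on_def)
  have i2: "inv_into (- {Some 0}) chart_infinity w = Some (1/w)" if "w \<noteq> 0" for w
  proof (rule inv_into_f_eq)
    show "inj_on chart_infinity (- {Some 0})"
      by (auto simp: inj_on_def chart_infinity_def split: option.splits)
  qed (use that in \<open>auto simp: chart_infinity_def\<close>)
  have cov: "range Some \<union> - {Some (0::complex)} = UNIV" "insert None (range Some) = (UNIV :: complex option set)"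
    by (auto simp: image_iff intro: option.exhaust)
  have s1: "the ` (range Some \<inter> - {Some (0::complex)}) = - {0}"
  proof -
    have "u \<in> the ` (range Some \<inter> - {Some 0})" if "u \<noteq> 0" for u :: complex
      using that by (intro image_eqI[of _ _ "Some u"]) auto
    then show ?thesis by auto
  qed
  have s2: "chart_infinity ` (- {Some 0} \<inter> range Some) = - {0}"
  proof -
    have "u \<in> chart_infinity ` (- {Some 0} \<inter> range Some)" if "u \<noteq> 0" for u
      using that by (intro image_eqI[of _ _ "Some (1/u)"]) (auto simp: chart_infinity_def)
    then show ?thesis by (auto simp: chart_infinity_def)
  qed
  have t1: "(chart_infinity \<circ> inv_into (range Some) the) holomorphic_on (- {0})"
    by (rule holomorphic_transform[of "\<lambda>w. 1/w"]) (auto simp: i1 chart_infinity_def intro!: holomorphic_intros)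
  have t2: "(the \<circ> inv_into (- {Some 0}) chart_infinity) holomorphic_on (- {0})"
    by (rule holomorphic_transform[of "\<lambda>w. 1/w"]) (auto simp: i2 intro!: holomorphic_intros)
  have t3: "(the \<circ> inv_into (range Some) the) holomorphic_on (UNIV :: complex set)"
    by (rule holomorphic_transform[of "\<lambda>w. w"]) (auto simp: i1 intro!: holomorphic_intros)
  have t4: "(chart_infinity \<circ> inv_into (- {Some 0}) chart_infinity) holomorphic_on UNIV"
    by (rule holomorphic_transform[of "\<lambda>w. w"]) (auto simp: f_inv_into_f r2 intro!: holomorphic_intros)
  show ?thesis
    unfolding riemann_surface_def P
    using H h op r1 r2 cov chart_infinity_homeo t1 t2 t3 t4
    by (simp add: chart_inv_def s1 s2)
qed

lemma line_bundle_pullback_bundle: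
  assumes X: "riemann_surface X" and Y: "riemann_surface Y"
    and q: "holomorphic_map X Y q" and L: "holomorphic_line_bundle Y L"
  shows "holomorphic_line_bundle X (pullback_bundle X q L)"
proof (rule holomorphic_line_bundleI)
  let ?P = "pullback_bundle X q L"
  note LD = holomorphic_line_bundleD[OF L]
  have qc: "continuous_map (topo X) (topo Y) q" using q by (simp add: holomorphic_map_def)
  have fr: "frames ?P = (\<lambda>c. (topspace (topo X) \<inter> q -` fst c, snd c \<circ> q)) ` frames L"
    unfolding pullback_bundle_def by force
  show "(\<Union>c\<in>frames ?P. fst c) = topspace (topo X)"
  proof -
    have "(\<Union>c\<in>frames ?P. fst c) = topspace (topo X) \<inter> q -` (\<Union>c\<in>frames L. fst c)"
      by (auto simp: fr)
    also have "\<dots> = topspace (topo X)" unfolding LD(1) using qc by (auto simp: continuous_map_def)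
    finally show ?thesis .
  qed
  have *: "openin (topo X) (topspace (topo X) \<inter> q -` U)" if "openin (topo Y) U" for U
    using openin_continuous_map_preimage[OF qc that] by (simp add: vimage_def Int_def)
  show "openin (topo X) U" if "(U, e) \<in> frames ?P" for U e
    using that * LD(2) by (auto simp: fr)
  show "bij_betw (\<lambda>a. vscale ?P p a (e p)) UNIV (fibre ?P p)"
    "vzero ?P p = vscale ?P p 0 (e p)"
    "vscale ?P p 1 (e p) = e p"
    "vadd ?P p (vscale ?P p a (e p)) (vscale ?P p b (e p)) = vscale ?P p (a + b) (e p)"
    "vscale ?P p a (vscale ?P p b (e p)) = vscale ?P p (a * b) (e p)"
    if "(U, e) \<in> frames ?P" "p \<in> U" for U e p a b
    using that LD(3-7) by (auto simp: pullback_bundle_def)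
  show "holomorphic_fun_on X (U0 \<inter> V0) (coefficient ?P e0 f0)"
    if f0: "(U0, e0) \<in> frames ?P" "(V0, f0) \<in> frames ?P" for U0 e0 V0 f0
  proof -
    from that obtain U e V f where f: "(U,e) \<in> frames L" "(V,f) \<in> frames L"
      and [simp]: "U0 = topspace (topo X) \<inter> q -` U" "e0 = e \<circ> q" "V0 = topspace (topo X) \<inter> q -` V" "f0 = f \<circ> q"
      by (auto simp: pullback_bundle_def)
    have UV: "openin (topo Y) U" "openin (topo Y) V" using LD(2) f by auto
    have h: "holomorphic_fun_on Y (U \<inter> V) (coefficient L e f)"
      using LD(8) f by blast
    have c: "coefficient (pullback_bundle X q L) e0 f0 p = coefficient L e f (q p)" for p
      by (simp add: coefficient_def pullback_bundle_def)
    show "holomorphic_fun_on X (U0 \<inter> V0) (coefficient (pullback_bundle X q L) e0 f0)"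
      unfolding holomorphic_fun_on_def
    proof
      fix b assume b: "b \<in> atlas X"
      have oW: "open (snd b ` (fst b \<inter> (U0 \<inter> V0)))"
        using * UV by (intro open_chart_image[OF X b]) auto
      have "(coefficient (pullback_bundle X q L) e0 f0 \<circ> chart_inv b) field_differentiable at x"
        if x: "x \<in> snd b ` (fst b \<inter> (U0 \<inter> V0))" for x
      proof -
        obtain p where p: "p \<in> fst b" "p \<in> U0" "p \<in> V0" "x = snd b p" using x by auto
        have "q p \<in> topspace (topo Y)" using p qc by (auto simp: continuous_map_def)
        then have "q p \<in> (\<Union>d\<in>atlas Y. fst d)" using Y by (simp add: riemann_surface_def)
        then obtain d where d: "d \<in> atlas Y" "q p \<in> fst d" by blast
        let ?S = "snd b ` (fst b \<inter> (topspace (topo X) \<inter> q -` (fst d \<inter> (U \<inter> V))))"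
        have oS: "open ?S" by (intro open_chart_image[OF X b] *) (auto intro: UV openin_chart_dom[OF Y d(1)])
        have "(((coefficient L e f \<circ> chart_inv d)) \<circ> (snd d \<circ> q \<circ> chart_inv b)) holomorphic_on ?S"
        proof (rule holomorphic_on_compose_gen)
          show "(snd d \<circ> q \<circ> chart_inv b) holomorphic_on ?S"
            using q b d by (auto simp: holomorphic_map_def intro: holomorphic_on_subset)
          show "(coefficient L e f \<circ> chart_inv d) holomorphic_on (snd d ` (fst d \<inter> (U \<inter> V)))"
            using h d by (auto simp: holomorphic_fun_on_def)
          show "(snd d \<circ> q \<circ> chart_inv b) ` ?S \<subseteq> snd d ` (fst d \<inter> (U \<inter> V))" using X b by auto
        qed
        then have "(coefficient (pullback_bundle X q L) e0 f0 \<circ> chart_inv b) holomorphic_on ?S"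
          by (rule holomorphic_transform) (use X Y b d c in auto)
        then show ?thesis using p d oS by (intro holomorphic_on_imp_differentiable_at[of _ ?S]) auto
      qed
      then show "(coefficient (pullback_bundle X q L) e0 f0 \<circ> chart_inv b) holomorphic_on (snd b ` (fst b \<inter> (U0 \<inter> V0)))"
        by (simp add: holomorphic_on_def field_differentiable_at_within)
    qed
  qed
qed

lemma fibre_expand:
  assumes "holomorphic_line_bundle X L" "(U, e) \<in> frames L" "p \<in> U" "v \<in> fibre L p"
  shows "\<exists>a. v = vscale L p a (e p)"
proof -
  have "v \<in> range (\<lambda>a. vscale L p a (e p))"
    unfolding bij_betw_imp_surj_on[OF holomorphic_line_bundleD(3)[OF assms(1-3)]] by (rule assms(4))
  then show ?thesis by (simp only: image_iff UNIV_I bex_UNIV)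
qed

lemma coefficient_eq:
  assumes "holomorphic_line_bundle X L" "(U, e) \<in> frames L" "p \<in> U"
  shows "s p \<in> fibre L p \<Longrightarrow> s p = vscale L p (coefficient L e s p) (e p)"
    and "s p = vscale L p a (e p) \<Longrightarrow> coefficient L e s p = a"
    and "e p \<in> fibre L p"
    and "vscale L p a (e p) = vscale L p b (e p) \<longleftrightarrow> a = b"
    and "vscale L p a (e p) \<in> fibre L p"
proof -
  note b = holomorphic_line_bundleD(3)[OF assms]
  show inj: "vscale L p a (e p) = vscale L p b (e p) \<longleftrightarrow> a = b" for a b
    using b by (auto simp: bij_betw_def inj_on_def)
  show in1: "vscale L p a (e p) \<in> fibre L p" for a using b by (auto simp: bij_betw_def)
  show "e p \<in> fibre L p" using in1[of 1] holomorphic_line_bundleD(5)[OF assms] by simp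
  show 1: "coefficient L e s p = a" if "s p = vscale L p a (e p)" for a
    unfolding coefficient_def that inj by (rule the_equality) auto
  show "s p = vscale L p (coefficient L e s p) (e p)" if sp: "s p \<in> fibre L p"
  proof -
    obtain a where a: "s p = vscale L p a (e p)" using fibre_expand[OF assms sp] ..
    show ?thesis unfolding 1[OF a] by (rule a)
  qed
qed

lemma line_bundle_hom_bundle:
  assumes X: "riemann_surface X"
    and L: "holomorphic_line_bundle X L" and M: "holomorphic_line_bundle X M"
  shows "holomorphic_line_bundle X (hom_bundle L M)"
proof (rule holomorphic_line_bundleI)
  let ?H = "hom_bundle L M"
  let ?h = "\<lambda>e f p. \<lambda>v\<in>fibre L p. vscale M p (THE a. v = vscale L p a (e p)) (f p)"
  note LD = holomorphic_line_bundleD[OF L] and MD = holomorphic_line_bundleD[OF M]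
  note Lc = coefficient_eq[OF L] and Mc = coefficient_eq[OF M]
  have fr: "frames ?H = {(U \<inter> V, ?h e f) | U e V f. (U, e) \<in> frames L \<and> (V, f) \<in> frames M}"
    by (simp add: hom_bundle_def)
  have sc: "vscale ?H p a k = (\<lambda>v\<in>fibre L p. vscale M p a (k v))" for p a k by (simp add: hom_bundle_def)
  have "topspace (topo X) \<subseteq> (\<Union>c\<in>frames ?H. fst c)"
  proof
    fix p assume "p \<in> topspace (topo X)"
    then have "p \<in> (\<Union>c\<in>frames L. fst c)" "p \<in> (\<Union>c\<in>frames M. fst c)" by (simp_all add: LD(1) MD(1))
    then obtain U e V f where "(U, e) \<in> frames L" "p \<in> U" "(V, f) \<in> frames M" "p \<in> V" by auto
    then have "(U \<inter> V, ?h e f) \<in> frames ?H" "p \<in> fst (U \<inter> V, ?h e f)" unfolding fr by (blast, simp)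
    then show "p \<in> (\<Union>c\<in>frames ?H. fst c)" by blast
  qed
  moreover have "(\<Union>c\<in>frames ?H. fst c) \<subseteq> topspace (topo X)"
    using LD(2) openin_subset by (fastforce simp: fr)
  ultimately show "(\<Union>c\<in>frames ?H. fst c) = topspace (topo X)" by blast
  have hv: "?h e f p (vscale L p a (e p)) = vscale M p a (f p)" if "(U, e) \<in> frames L" "p \<in> U" for U e f p a
    using Lc(5)[OF that] Lc(4)[OF that] by simp
  have ext: "k = k'" if Uep: "(U, e) \<in> frames L" "p \<in> U" and kk: "k \<in> extensional (fibre L p)" "k' \<in> extensional (fibre L p)"
      and eq: "\<And>a. k (vscale L p a (e p)) = k' (vscale L p a (e p))" for U e p and k k' :: "'b \<Rightarrow> 'c"
  proof (rule extensionalityI[OF kk])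
    fix v assume v: "v \<in> fibre L p"
    obtain a where "v = vscale L p a (e p)" using fibre_expand[OF L Uep v] ..
    then show "k v = k' v" using eq by simp
  qed
  fix W h assume "(W, h) \<in> frames ?H"
  then obtain U e V f where Ue: "(U, e) \<in> frames L" and Vf: "(V, f) \<in> frames M"
    and W: "W = U \<inter> V" and h: "h = ?h e f" by (auto simp: fr)
  show "openin (topo X) W" unfolding W using LD(2)[OF Ue] MD(2)[OF Vf] by (rule openin_Int)
  { fix p assume "p \<in> W"
    then have p: "p \<in> U" "p \<in> V" by (auto simp: W)
    note Le = Lc[OF Ue p(1)] and Mf = Mc[OF Vf p(2)]
    have hv': "h p (vscale L p a (e p)) = vscale M p a (f p)" for a
      unfolding h by (rule hv[OF Ue p(1)])
    have sv: "vscale ?H p t (h p) (vscale L p a (e p)) = vscale M p (t * a) (f p)" for t a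
      using Le(5) hv' MD(7)[OF Vf p(2)] by (simp add: sc)
    have sv2: "vscale ?H p t (h p) \<in> extensional (fibre L p)" for t by (simp add: sc)
    have hfib: "vscale ?H p t (h p) \<in> fibre ?H p" for t
    proof -
      have v: "\<exists>a. v = vscale L p a (e p)" if "v \<in> fibre L p" for v
        by (rule fibre_expand[OF L Ue p(1) that])
      have "vscale ?H p t (h p) v \<in> fibre M p" if "v \<in> fibre L p" for v
        using v[OF that] sv Mf(5) by metis
      moreover have "vscale ?H p t (h p) (vadd L p v w) = vadd M p (vscale ?H p t (h p) v) (vscale ?H p t (h p) w)"
        if vw: "v \<in> fibre L p" "w \<in> fibre L p" for v w
      proof -
        obtain a b where "v = vscale L p a (e p)" "w = vscale L p b (e p)" using v vw by metis
        then show ?thesis by (simp add: sv LD(6)[OF Ue p(1)] MD(6)[OF Vf p(2)] distrib_left)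
      qed
      moreover have "vscale ?H p t (h p) (vscale L p a v) = vscale M p a (vscale ?H p t (h p) v)"
        if vw: "v \<in> fibre L p" for v a
      proof -
        obtain b where "v = vscale L p b (e p)" using v vw by metis
        then show ?thesis by (simp add: sv LD(7)[OF Ue p(1)] MD(7)[OF Vf p(2)] mult_ac)
      qed
      ultimately have "vscale ?H p t (h p) \<in> {h \<in> fibre L p \<rightarrow>\<^sub>E fibre M p.
           (\<forall>v\<in>fibre L p. \<forall>w\<in>fibre L p. h (vadd L p v w) = vadd M p (h v) (h w)) \<and>
           (\<forall>a. \<forall>v\<in>fibre L p. h (vscale L p a v) = vscale M p a (h v))}"
        using sv2 by (simp add: PiE_iff)
      then show ?thesis by (simp add: hom_bundle_def)
    qed
    show "bij_betw (\<lambda>t. vscale ?H p t (h p)) UNIV (fibre ?H p)"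
      unfolding bij_betw_def
    proof (intro conjI injI equalityI subsetI)
      fix t t' assume "vscale ?H p t (h p) = vscale ?H p t' (h p)"
      then have "vscale M p (t * 1) (f p) = vscale M p (t' * 1) (f p)" using sv by metis
      then show "t = t'" using Mf(4) by simp
    next
      fix k assume "k \<in> range (\<lambda>t. vscale ?H p t (h p))" then show "k \<in> fibre ?H p" using hfib by auto
    next
      fix k assume k: "k \<in> fibre ?H p"
      then have kP: "k \<in> fibre L p \<rightarrow>\<^sub>E fibre M p"
        and ks: "\<And>a v. v \<in> fibre L p \<Longrightarrow> k (vscale L p a v) = vscale M p a (k v)"
        by (auto simp: hom_bundle_def)
      have kf: "k (e p) \<in> fibre M p" using kP Le(3) by auto
      obtain t where t: "k (e p) = vscale M p t (f p)" using fibre_expand[OF M Vf p(2) kf] ..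
      have "k = vscale ?H p t (h p)"
      proof (rule ext[OF Ue p(1) _ sv2])
        show "k \<in> extensional (fibre L p)" using kP by (simp add: PiE_iff)
        show "k (vscale L p a (e p)) = vscale ?H p t (h p) (vscale L p a (e p))" for a
          unfolding sv ks[OF Le(3)] t MD(7)[OF Vf p(2)] by (simp add: mult.commute)
      qed
      then show "k \<in> range (\<lambda>t. vscale ?H p t (h p))" by blast
    qed
    have hext: "h p \<in> extensional (fibre L p)" by (simp add: h)
    show "vzero ?H p = vscale ?H p 0 (h p)"
    proof (rule ext[OF Ue p(1) _ sv2])
      show "vzero ?H p \<in> extensional (fibre L p)" by (simp add: hom_bundle_def)
      show "vzero ?H p (vscale L p a (e p)) = vscale ?H p 0 (h p) (vscale L p a (e p))" for a
        unfolding sv using Le(5) MD(4)[OF Vf p(2)] by (simp add: hom_bundle_def)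
    qed
    show "vscale ?H p 1 (h p) = h p"
      by (rule ext[OF Ue p(1) sv2 hext]) (simp add: sv hv')
    show "vadd ?H p (vscale ?H p a (h p)) (vscale ?H p b (h p)) = vscale ?H p (a + b) (h p)" for a b
    proof (rule ext[OF Ue p(1) _ sv2])
      show "vadd ?H p (vscale ?H p a (h p)) (vscale ?H p b (h p)) \<in> extensional (fibre L p)"
        by (simp add: hom_bundle_def)
      have "vadd ?H p k k' v = vadd M p (k v) (k' v)" if "v \<in> fibre L p" for k k' v
        using that by (simp add: hom_bundle_def)
      then show "vadd ?H p (vscale ?H p a (h p)) (vscale ?H p b (h p)) (vscale L p x (e p)) =
            vscale ?H p (a + b) (h p) (vscale L p x (e p))" for x
        using Le(5) by (simp add: sv MD(6)[OF Vf p(2)] distrib_right)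
    qed
    show "vscale ?H p a (vscale ?H p b (h p)) = vscale ?H p (a * b) (h p)" for a b
    proof (rule ext[OF Ue p(1) _ sv2])
      show "vscale ?H p a (vscale ?H p b (h p)) \<in> extensional (fibre L p)" by (simp add: sc)
      have "vscale ?H p a k v = vscale M p a (k v)" if "v \<in> fibre L p" for k v
        using that by (simp add: sc)
      then show "vscale ?H p a (vscale ?H p b (h p)) (vscale L p x (e p)) =
            vscale ?H p (a * b) (h p) (vscale L p x (e p))" for x
        using Le(5) by (simp add: sv MD(7)[OF Vf p(2)] mult.assoc)
    qed
    have "vscale ?H p t (h p) (vscale L p a (e p)) = vscale M p (t * a) (f p)" for t a by (rule sv)
  } note sv = this
  fix W' h' assume "(W', h') \<in> frames ?H"
  then obtain U' e' V' f' where Ue': "(U', e') \<in> frames L" and Vf': "(V', f') \<in> frames M"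
    and W': "W' = U' \<inter> V'" and h': "h' = ?h e' f'" by (auto simp: fr)
  have *: "coefficient ?H h h' p = coefficient L e' e p * coefficient M f f' p"
    if p: "p \<in> U" "p \<in> V" "p \<in> U'" "p \<in> V'" for p
  proof -
    let ?g = "coefficient L e' e p" and ?k = "coefficient M f f' p"
    note Le = Lc[OF Ue p(1)] and Mf = Mc[OF Vf p(2)] and Le' = Lc[OF Ue' p(3)] and Mf' = Mc[OF Vf' p(4)]
    have e: "e p = vscale L p ?g (e' p)" by (rule Le'(1)[of e, OF Le(3)])
    have f: "f' p = vscale M p ?k (f p)" by (rule Mf(1)[of f', OF Mf'(3)])
    have pW: "p \<in> W" using p by (simp add: W)
    have h'e: "h' p (vscale L p a (e p)) = vscale M p (a * (?g * ?k)) (f p)" for a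
    proof -
      have "vscale L p a (e p) = vscale L p (a * ?g) (e' p)" by (subst e) (rule LD(7)[OF Ue' p(3)])
      then have "h' p (vscale L p a (e p)) = vscale M p (a * ?g) (f' p)"
        using hv[OF Ue' p(3), of f'] unfolding h' by simp
      also have "\<dots> = vscale M p (a * ?g * ?k) (f p)" by (subst f) (rule MD(7)[OF Vf p(2)])
      finally show ?thesis by (simp add: mult.assoc)
    qed
    have "h' p = vscale ?H p t (h p) \<longleftrightarrow> t = ?g * ?k" for t
    proof
      assume "h' p = vscale ?H p t (h p)"
      then have "vscale M p (1 * (?g * ?k)) (f p) = vscale M p (t * 1) (f p)"
        using h'e[of 1] sv[OF pW, of t 1] by simp
      then show "t = ?g * ?k" using Mf(4) by simp
    next
      assume "t = ?g * ?k"
      then show "h' p = vscale ?H p t (h p)"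
        by (intro ext[OF Ue p(1)]) (simp_all add: h'e sv[OF pW] mult.commute, simp_all add: h' sc)
    qed
    then show ?thesis unfolding coefficient_def[of ?H] by simp
  qed
  show "holomorphic_fun_on X (W \<inter> W') (coefficient ?H h h')"
    unfolding holomorphic_fun_on_def
  proof
    fix b assume b: "b \<in> atlas X"
    let ?S = "snd b ` (fst b \<inter> (W \<inter> W'))"
    have "(coefficient L e' e \<circ> chart_inv b) holomorphic_on ?S"
      by (rule holomorphic_on_subset[OF LD(8)[OF Ue' Ue, unfolded holomorphic_fun_on_def, rule_format, OF b]]) (auto simp: W W')
    moreover have "(coefficient M f f' \<circ> chart_inv b) holomorphic_on ?S"
      by (rule holomorphic_on_subset[OF MD(8)[OF Vf Vf', unfolded holomorphic_fun_on_def, rule_format, OF b]]) (auto simp: W W')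
    ultimately have "(\<lambda>x. (coefficient L e' e \<circ> chart_inv b) x * (coefficient M f f' \<circ> chart_inv b) x) holomorphic_on ?S"
      by (rule holomorphic_on_mult)
    then show "(coefficient ?H h h' \<circ> chart_inv b) holomorphic_on ?S"
      by (rule holomorphic_transform) (use * X b in \<open>auto simp: W W'\<close>)
  qed
qed

corollary line_bundle_relative_hom_bundle:
  assumes "riemann_surface X" "holomorphic_map X P1 q" "holomorphic_map X P1 z"
  shows "holomorphic_line_bundle X (relative_hom_bundle X q z)"
  unfolding relative_hom_bundle_def
  by (intro line_bundle_hom_bundle line_bundle_pullback_bundle[OF assms(1) riemann_surface_P1]
      line_bundle_tangent_bundle riemann_surface_P1 assms)

end

theory Submission
  imports Defs
begin

text \<open>Choose a chart \<open>c\<close> of \<open>X\<close> at a point \<open>p\<close> and charts of the projective line at \<open>q(p)\<close> and \<open>z(p)\<close>.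
  In the induced frames, \<open>Tq\<close> and \<open>Tz\<close> are multiplication by the derivatives \<open>q'\<close> and \<open>z'\<close> of the local
  representatives of the maps (\<open>differential_coefficient\<close>), so the multiplicities of \<open>p\<close> in the
  ramification divisors are the orders of \<open>q'\<close> and \<open>z'\<close>. The composition \<open>Tz \<circ> (Tq)\<^sup>-\<^sup>1\<close> is
  multiplication by \<open>z' / q'\<close> (\<open>relative_differential_coordinates\<close>), whose order is the difference of
  the two orders.

  Three facts make this local computation meaningful. The order of a section may be computed in a single
  frame and a single chart (\<open>section_order_eq_zorder\<close>), since a change of frame multiplies the
  coefficient by a holomorphic function without zeros and a change of chart is a local biholomorphism.
  By the identity theorem (\<open>holomorphic_map_eq_constant\<close>) neither \<open>q'\<close> nor \<open>z'\<close> vanishes identically near a point,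
  because the maps are not constant and \<open>X\<close> is connected; so the orders are finite and the ramification
  points are isolated. Finally, \<open>X\<close> being compact, isolation makes the ramification divisors finite.\<close>

section \<open>Charts and local representatives\<close>

abbreviation local_rep :: "'a chart \<Rightarrow> 'b chart \<Rightarrow> ('a \<Rightarrow> 'b) \<Rightarrow> complex \<Rightarrow> complex" where
  "local_rep c d f \<equiv> snd d \<circ> f \<circ> chart_inv c"

lemma charts_atD:
  assumes "c \<in> charts_at X p" shows "c \<in> atlas X" "p \<in> fst c"
  using assms by (auto simp: charts_at_def)

lemma charts_at_nonempty:
  assumes "riemann_surface X" "p \<in> topspace (topo X)"
  obtains c where "c \<in> charts_at X p"
proof -
  have "p \<in> (\<Union>c\<in>atlas X. fst c)" using assms by (simp add: riemann_surface_def)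
  then show ?thesis using that by (auto simp only: charts_at_def mem_Collect_eq UN_iff)
qed

text \<open>Discs in a coordinate give neighbourhoods on the surface. Together with the openness of
  charts this lets open sets pass back and forth between \<open>X\<close> and the complex plane.\<close>

lemma openin_chart_vimage:
  assumes X: "riemann_surface X" and c: "c \<in> atlas X" and B: "open B"
  shows "openin (topo X) (fst c \<inter> snd c -` B)"
proof -
  let ?T = "subtopology (topo X) (fst c)"
  have "homeomorphic_map ?T (top_of_set (snd c ` fst c)) (snd c)"
    using X c by (auto simp: riemann_surface_def)
  then have "continuous_map ?T (top_of_set (snd c ` fst c)) (snd c)"
    by (rule homeomorphic_imp_continuous_map)
  then have "continuous_map ?T euclidean (snd c)"
    by (simp add: continuous_map_in_subtopology)
  then have "openin ?T {x \<in> topspace ?T. snd c x \<in> B}"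
    using B by (intro openin_continuous_map_preimage) auto
  moreover have "{x \<in> topspace ?T. snd c x \<in> B} = fst c \<inter> snd c -` B"
    using chart_dom_subset[OF X c] by auto
  ultimately show ?thesis
    using openin_trans_full openin_chart_dom[OF X c] by metis
qed

text \<open>Statements about a punctured neighbourhood of \<open>p\<close> can be tested in any chart. Since the left
  side mentions no chart, this is also the tool for changing from one chart at \<open>p\<close> to another.\<close>

lemma eventually_atin_chart:
  assumes X: "riemann_surface X" and c: "c \<in> charts_at X p"
  shows "eventually P (atin (topo X) p) \<longleftrightarrow> (\<forall>\<^sub>F w in at (snd c p). P (chart_inv c w))"
proof
  note cD = charts_atD[OF c]
  have pX: "p \<in> topspace (topo X)" using chart_dom_subset[OF X cD(1)] cD(2) by auto
  assume "eventually P (atin (topo X) p)"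
  then obtain U where U: "openin (topo X) U" "p \<in> U" "\<forall>x\<in>U - {p}. P x"
    using pX by (auto simp: eventually_atin)
  have "open (snd c ` (fst c \<inter> U))" "snd c p \<in> snd c ` (fst c \<inter> U)"
    using open_chart_image[OF X cD(1) U(1)] U(2) cD(2) by auto
  then have "\<forall>\<^sub>F w in at (snd c p). w \<in> snd c ` (fst c \<inter> U) - {snd c p}"
    by (intro eventually_at_in_open)
  then show "\<forall>\<^sub>F w in at (snd c p). P (chart_inv c w)"
    by eventually_elim (use U(3) X cD in auto)
next
  note cD = charts_atD[OF c]
  assume "\<forall>\<^sub>F w in at (snd c p). P (chart_inv c w)"
  then obtain B where B: "open B" "snd c p \<in> B" "\<forall>w\<in>B. w \<noteq> snd c p \<longrightarrow> P (chart_inv c w)"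
    by (auto simp: eventually_at_topological)
  have "\<forall>x\<in>(fst c \<inter> snd c -` B) - {p}. P x"
  proof
    fix x assume x: "x \<in> (fst c \<inter> snd c -` B) - {p}"
    then have "snd c x \<noteq> snd c p"
      using inj_chart[OF X cD(1)] cD(2) by (auto dest: inj_onD)
    then show "P x" using x B(3) chart_inv_chart[OF X cD(1), of x] by auto
  qed
  then show "eventually P (atin (topo X) p)"
    unfolding eventually_atin using openin_chart_vimage[OF X cD(1) B(1)] B(2) cD(2)
    by (intro disjI2 exI[of _ "fst c \<inter> snd c -` B"]) auto
qed

lemma local_rep_holomorphic:
  assumes X: "riemann_surface X" and Y: "riemann_surface Y" and f: "holomorphic_map X Y f"
    and c: "c \<in> charts_at X p" and d: "d \<in> charts_at Y (f p)"
  shows "open (snd c ` (fst c \<inter> f -` fst d))" (is ?o)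
    and "snd c p \<in> snd c ` (fst c \<inter> f -` fst d)" (is ?i)
    and "local_rep c d f holomorphic_on (snd c ` (fst c \<inter> f -` fst d))" (is ?h)
    and "local_rep c d f analytic_on {snd c p}"
proof -
  note cD = charts_atD[OF c] and dD = charts_atD[OF d]
  have "fst c \<inter> f -` fst d = fst c \<inter> {x \<in> topspace (topo X). f x \<in> fst d}"
    using chart_dom_subset[OF X cD(1)] by auto
  moreover have "openin (topo X) {x \<in> topspace (topo X). f x \<in> fst d}"
    using f openin_chart_dom[OF Y dD(1)] openin_continuous_map_preimage
    unfolding holomorphic_map_def by blast
  ultimately show 1: ?o using open_chart_image[OF X cD(1)] by metis
  show 2: ?i using cD dD by auto
  show 3: ?h using f cD dD by (auto simp: holomorphic_map_def)
  show "local_rep c d f analytic_on {snd c p}"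
    using 1 2 3 by (auto simp: analytic_at)
qed

text \<open>With the identity as a holomorphic map, the transition functions \<open>snd d \<circ> chart_inv c\<close> become
  special local representatives. The chain rule below then also yields the transformation laws of
  derivatives under a change of chart in the source and in the target.\<close>

lemma holomorphic_map_id: "riemann_surface X \<Longrightarrow> holomorphic_map X X id"
  using holo_trans(1) by (auto simp: holomorphic_map_def)

lemma deriv_local_rep_compose:
  assumes X: "riemann_surface X" and Y: "riemann_surface Y" and Z: "riemann_surface Z"
    and f: "holomorphic_map X Y f" and g: "holomorphic_map Y Z g"
    and c: "c \<in> charts_at X p" and d: "d \<in> charts_at Y (f p)" and e: "e \<in> charts_at Z (g (f p))"
  shows "deriv (local_rep c e (g \<circ> f)) (snd c p) =
         deriv (local_rep d e g) (snd d (f p)) * deriv (local_rep c d f) (snd c p)"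
proof -
  note F = local_rep_holomorphic[OF X Y f c d] and G = local_rep_holomorphic[OF Y Z g d e]
  note cD = charts_atD[OF c] and dD = charts_atD[OF d]
  have v: "local_rep c d f (snd c p) = snd d (f p)" using X cD by simp
  have "\<forall>\<^sub>F w in nhds (snd c p). w \<in> snd c ` (fst c \<inter> f -` fst d)"
    using F(1,2) by (rule eventually_nhds_in_open)
  then have "\<forall>\<^sub>F w in nhds (snd c p). local_rep c e (g \<circ> f) w = (local_rep d e g \<circ> local_rep c d f) w"
    by eventually_elim (use X Y cD dD in auto)
  then have "deriv (local_rep c e (g \<circ> f)) (snd c p) =
      deriv (local_rep d e g \<circ> local_rep c d f) (snd c p)"
    by (rule deriv_cong_ev) simp
  also have "\<dots> = deriv (local_rep d e g) (local_rep c d f (snd c p)) * deriv (local_rep c d f) (snd c p)"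
    by (rule deriv_chain) (use F(4) G(4) v in \<open>auto intro: analytic_on_imp_differentiable_at\<close>)
  finally show ?thesis unfolding v .
qed

section \<open>The identity theorem\<close>

text \<open>The largest open set \<open>A\<close> on which \<open>f\<close> is \<open>y\<close> has an open complement:
  if a coordinate disc around a point meets \<open>A\<close>, analytic continuation of the local representative
  of \<open>f\<close> spreads the value \<open>y\<close> over the whole disc. So connectedness leaves no room outside \<open>A\<close>.\<close>

lemma holomorphic_map_eq_constant:
  assumes X: "riemann_surface X" and Y: "riemann_surface Y" and f: "holomorphic_map X Y f"
    and conn: "connected_space (topo X)"
    and U: "openin (topo X) U" "U \<noteq> {}" "\<And>x. x \<in> U \<Longrightarrow> f x = y"
    and p: "p \<in> topspace (topo X)"
  shows "f p = y"
proof -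
  \<comment> \<open>the interior of the fibre over \<open>y\<close>\<close>
  define A where "A = \<Union>{V. openin (topo X) V \<and> (\<forall>x\<in>V. f x = y)}"
  have A: "openin (topo X) A" unfolding A_def by (rule openin_Union) auto
  have Ay: "f x = y" if "x \<in> A" for x using that by (auto simp: A_def)
  have "\<exists>V. openin (topo X) V \<and> x \<in> V \<and> V \<subseteq> topspace (topo X) - A"
    if x: "x \<in> topspace (topo X) - A" for x
  proof -
    obtain c where c: "c \<in> charts_at X x" using charts_at_nonempty[OF X] x by blast
    have "f x \<in> topspace (topo Y)"
      using f x by (auto simp: holomorphic_map_def continuous_map_def)
    then obtain d where d: "d \<in> charts_at Y (f x)" using charts_at_nonempty[OF Y] by blast
    note F = local_rep_holomorphic[OF X Y f c d] and cD = charts_atD[OF c] and dD = charts_atD[OF d]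
    obtain r where r: "r > 0" "ball (snd c x) r \<subseteq> snd c ` (fst c \<inter> f -` fst d)"
      using F(1,2) openE by blast
    define V where "V = fst c \<inter> snd c -` ball (snd c x) r"
    have V: "openin (topo X) V" unfolding V_def by (rule openin_chart_vimage[OF X cD(1)]) simp
    have fV: "f v \<in> fst d" if "v \<in> V" for v
    proof -
      have "snd c v \<in> snd c ` (fst c \<inter> f -` fst d)" using that r by (auto simp: V_def)
      then show ?thesis using that inj_chart[OF X cD(1)] by (auto simp: V_def dest: inj_onD)
    qed
    have "V \<inter> A = {}"
    proof (rule ccontr)
      assume "V \<inter> A \<noteq> {}"
      then obtain v where v: "v \<in> V" "v \<in> A" by blast
      have y: "y \<in> fst d" using fV[OF v(1)] Ay[OF v(2)] by simp
      have eq: "local_rep c d f w = snd d y" if "w \<in> ball (snd c x) r" for w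
      proof (rule analytic_continuation_open[where s = "snd c ` (fst c \<inter> (V \<inter> A))"
            and s' = "ball (snd c x) r" and f = "local_rep c d f" and g = "\<lambda>_. snd d y"])
        show "open (snd c ` (fst c \<inter> (V \<inter> A)))"
          by (rule open_chart_image[OF X cD(1)]) (use V A in blast)
        show "snd c ` (fst c \<inter> (V \<inter> A)) \<noteq> {}" using v by (auto simp: V_def)
        show "local_rep c d f holomorphic_on ball (snd c x) r"
          using F(3) r(2) by (rule holomorphic_on_subset)
      qed (use that Ay X cD in \<open>auto simp: V_def\<close>)
      have "f v' = y" if v': "v' \<in> V" for v'
      proof -
        have "snd d (f v') = snd d y"
          using eq[of "snd c v'"] v' X cD by (auto simp: V_def)
        then show ?thesis using inj_chart[OF Y dD(1)] fV[OF v'] y by (auto dest: inj_onD)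
      qed
      then have "V \<subseteq> A" using V by (auto simp: A_def)
      moreover have "x \<in> V" using r cD by (simp add: V_def)
      ultimately show False using x by auto
    qed
    then show ?thesis using V r cD openin_subset[OF V] by (intro exI[of _ V]) (auto simp: V_def)
  qed
  then have "openin (topo X) (topspace (topo X) - A)" by (subst openin_subopen) blast
  moreover have "A \<noteq> {}" using U unfolding A_def by blast
  ultimately have "A = topspace (topo X)"
    using conn A openin_subset[OF A] unfolding connected_space_def by blast
  then show ?thesis using p Ay by blast
qed

text \<open>Were the derivative zero on a disc, the map would be constant there and hence, by the identity
  theorem, everywhere. So ramification points are isolated.\<close>

lemma deriv_local_rep_eventually_nonzero:
  assumes X: "riemann_surface X" and Y: "riemann_surface Y" and f: "holomorphic_map X Y f"
    and conn: "connected_space (topo X)"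
    and nonconst: "\<not> (\<exists>y. \<forall>p\<in>topspace (topo X). f p = y)"
    and c: "c \<in> charts_at X p" and d: "d \<in> charts_at Y (f p)"
  shows "\<forall>\<^sub>F w in at (snd c p). deriv (local_rep c d f) w \<noteq> 0"
proof -
  note F = local_rep_holomorphic[OF X Y f c d] and cD = charts_atD[OF c] and dD = charts_atD[OF d]
  obtain r where r: "r > 0" "ball (snd c p) r \<subseteq> snd c ` (fst c \<inter> f -` fst d)"
    using F(1,2) openE by blast
  let ?B = "ball (snd c p) r"
  have h: "local_rep c d f holomorphic_on ?B" using F(3) r(2) by (rule holomorphic_on_subset)
  have "\<exists>w\<in>?B. deriv (local_rep c d f) w \<noteq> 0"
  proof (rule ccontr)
    assume z: "\<not> ?thesis"
    have "(local_rep c d f has_field_derivative 0) (at w)" if "w \<in> ?B" for w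
      using holomorphic_derivI[OF h _ that] z that by force
    then obtain k where k: "\<And>w. w \<in> ?B \<Longrightarrow> local_rep c d f w = k"
      using has_field_derivative_zero_constant[of ?B "local_rep c d f"]
      by (metis DERIV_subset convex_ball top_greatest)
    let ?V = "fst c \<inter> snd c -` ?B"
    have "f x = f p" if "x \<in> ?V" for x
    proof -
      have "snd c x \<in> snd c ` (fst c \<inter> f -` fst d)" using that r by auto
      then have "f x \<in> fst d" using that inj_chart[OF X cD(1)] by (auto dest: inj_onD)
      moreover have "snd d (f x) = snd d (f p)"
        using k[of "snd c x"] k[of "snd c p"] r(1) that X cD by auto
      ultimately show ?thesis using inj_chart[OF Y dD(1)] dD(2) by (auto dest: inj_onD)
    qed
    moreover have "openin (topo X) ?V" by (rule openin_chart_vimage[OF X cD(1)]) simp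
    moreover have "?V \<noteq> {}" using r(1) cD(2) by auto
    ultimately have "\<forall>x\<in>topspace (topo X). f x = f p"
      using holomorphic_map_eq_constant[OF X Y f conn] by blast
    then show False using nonconst by blast
  qed
  then obtain w where "w \<in> ?B" "deriv (local_rep c d f) w \<noteq> 0" by blast
  then have "\<forall>\<^sub>F w in at (snd c p). deriv (local_rep c d f) w \<noteq> 0 \<and> w \<in> ?B"
    using r(1) h by (intro non_zero_neighbour_alt holomorphic_deriv) auto
  then show ?thesis by eventually_elim simp
qed

section \<open>Orders of sections\<close>

text \<open>A local biholomorphism has a Taylor expansion that starts in degree one, and orders are
  multiplicative under composition.\<close>

lemma zorder_compose_deriv_nonzero:
  assumes f: "f meromorphic_on {g z}" "\<forall>\<^sub>F w in at (g z). f w \<noteq> 0"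
    and g: "g analytic_on {z}" "deriv g z \<noteq> 0"
  shows "zorder (f \<circ> g) z = zorder f (g z)"
proof -
  define G where "G = fps_expansion g z - fps_const (g z)"
  have "(\<lambda>x. g (z + x) - g z) has_fps_expansion G"
    unfolding G_def by (intro fps_expansion_intros analytic_at_imp_has_fps_expansion g)
  moreover have "subdegree G = 1"
    using g(2) by (intro subdegreeI) (auto simp: G_def fps_expansion_def)
  moreover have "G \<noteq> 0" using \<open>subdegree G = 1\<close> by auto
  ultimately show ?thesis
    using zorder_compose[of f g z G] f by (simp add: meromorphic_at_iff)
qed

lemma line_bundle_frame_nonzero:
  assumes L: "holomorphic_line_bundle X L" and U: "(U, e) \<in> frames L" "p \<in> U"
  shows "vscale L p a (e p) = vzero L p \<longleftrightarrow> a = 0"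
  unfolding holomorphic_line_bundleD(4)[OF L U] by (rule coefficient_eq(4)[OF L U])

lemma holomorphic_frame_on_frame:
  assumes L: "holomorphic_line_bundle X L" and U: "(U, e) \<in> frames L"
  shows "holomorphic_frame_on X L U e"
proof -
  note LD = holomorphic_line_bundleD[OF L]
  have "e p \<noteq> vzero L p" if "p \<in> U" for p
    using line_bundle_frame_nonzero[OF L U that, of 1] LD(5)[OF U that] by simp
  moreover have "holomorphic_fun_on X (V \<inter> U) (coefficient L f e)" if "(V, f) \<in> frames L" for V f
    using LD(8)[OF that U] .
  ultimately show ?thesis
    using LD(2)[OF U] coefficient_eq(3)[OF L U]
    by (auto simp: holomorphic_frame_on_def holomorphic_section_on_def)
qed

text \<open>Two
  frames differ by a factor \<open>g\<close> that is holomorphic without zeros, so the coefficient is divided by a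
  function of order 0; two charts differ by the biholomorphism \<open>\<phi>\<close>, which preserves orders. The
  section needs to lie in the fibres only on a punctured neighbourhood of \<open>p\<close>, which leaves room for
  poles and for sections that are undefined at \<open>p\<close>.\<close>

lemma zorder_coefficient_frame_chart_independent:
  assumes X: "riemann_surface X" and L: "holomorphic_line_bundle X L"
    and U: "(U, e) \<in> frames L" "p \<in> U" and c: "c \<in> charts_at X p"
    and s: "eventually (\<lambda>x. s x \<in> fibre L x) (atin (topo X) p)"
    and mero: "(coefficient L e s \<circ> chart_inv c) meromorphic_on {snd c p}"
    and nz: "\<forall>\<^sub>F w in at (snd c p). coefficient L e s (chart_inv c w) \<noteq> 0"
    and W: "holomorphic_frame_on X L W f" "p \<in> W" and d: "d \<in> charts_at X p"
  shows "zorder (coefficient L f s \<circ> chart_inv d) (snd d p) =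
         zorder (coefficient L e s \<circ> chart_inv c) (snd c p)"
proof -
  note cD = charts_atD[OF c] and dD = charts_atD[OF d]
  note LD = holomorphic_line_bundleD[OF L]
  define F where "F = coefficient L e s"
  define g where "g = coefficient L e f"
  define \<phi> where "\<phi> = snd c \<circ> chart_inv d"
  have oW: "openin (topo X) W" and fs: "holomorphic_section_on X L W f"
    and fnz: "\<And>x. x \<in> W \<Longrightarrow> f x \<noteq> vzero L x"
    using W(1) by (auto simp: holomorphic_frame_on_def)
  have fe: "f x = vscale L x (g x) (e x)" if "x \<in> U" "x \<in> W" for x
    unfolding g_def using that fs coefficient_eq(1)[OF L U(1)]
    by (auto simp: holomorphic_section_on_def)
  have g0: "g x \<noteq> 0" if "x \<in> U" "x \<in> W" for x
    using fnz[OF that(2)] fe[OF that] line_bundle_frame_nonzero[OF L U(1) that(1)] by auto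
  have quot: "coefficient L f s x = F x / g x" if x: "x \<in> U" "x \<in> W" and sx: "s x \<in> fibre L x" for x
  proof -
    have "s x = vscale L x (F x) (e x)"
      unfolding F_def by (rule coefficient_eq(1)[where s = s, OF L U(1) x(1) sx])
    then have *: "s x = vscale L x a (f x) \<longleftrightarrow> F x = a * g x" for a
      using fe[OF x] LD(7)[OF U(1) x(1)] coefficient_eq(4)[OF L U(1) x(1)] by simp
    then show ?thesis
      unfolding coefficient_def * using g0[OF x] by (intro the_equality) (auto simp: field_simps)
  qed
  have \<phi>p: "\<phi> (snd d p) = snd c p" using X dD by (simp add: \<phi>_def)
  have \<phi>a: "\<phi> analytic_on {snd d p}"
    using holo_trans[OF X dD(1) cD(1)] cD(2) dD(2) unfolding \<phi>_def
    by (auto simp: analytic_at intro!: exI[of _ "snd d ` (fst d \<inter> fst c)"])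
  \<comment> \<open>by the chain rule, \<open>\<phi>'\<close> times the derivative of the inverse transition function is 1\<close>
  have \<phi>d: "deriv \<phi> (snd d p) \<noteq> 0"
    using trans_deriv[OF X d c d] trans_deriv_self[OF X d] unfolding \<phi>_def by auto
  have ga: "(g \<circ> chart_inv d) analytic_on {snd d p}"
  proof -
    have "(g \<circ> chart_inv d) holomorphic_on (snd d ` (fst d \<inter> (U \<inter> W)))"
      using fs U(1) dD(1) by (auto simp: holomorphic_section_on_def holomorphic_fun_on_def g_def)
    moreover have "open (snd d ` (fst d \<inter> (U \<inter> W)))"
      by (intro open_chart_image[OF X dD(1)] openin_Int LD(2)[OF U(1)] oW)
    ultimately show ?thesis using U(2) W(2) dD(2) by (auto simp: analytic_at)
  qed
  have gp: "(g \<circ> chart_inv d) (snd d p) \<noteq> 0" using g0[OF U(2) W(2)] X dD by simp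
  have near: "eventually (\<lambda>x. x \<in> U \<inter> W \<inter> fst c) (atin (topo X) p)"
    unfolding eventually_atin
    by (intro disjI2 exI[of _ "U \<inter> W \<inter> fst c"])
       (use LD(2)[OF U(1)] oW openin_chart_dom[OF X cD(1)] U(2) W(2) cD(2) in auto)
  \<comment> \<open>writing \<open>x\<close> as \<open>chart_inv c (snd c x)\<close> makes \<open>\<phi>\<close> appear when \<open>x\<close> is expressed in the chart \<open>d\<close>\<close>
  have "eventually (\<lambda>x. coefficient L f s x = F (chart_inv c (snd c x)) / g x) (atin (topo X) p)"
    using near s by eventually_elim (use quot X cD in auto)
  then have "\<forall>\<^sub>F w in at (snd d p). (coefficient L f s \<circ> chart_inv d) w =
      ((F \<circ> chart_inv c) \<circ> \<phi>) w / (g \<circ> chart_inv d) w"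
    unfolding eventually_atin_chart[OF X d] by (simp add: \<phi>_def)
  then have "zorder (coefficient L f s \<circ> chart_inv d) (snd d p) =
      zorder (\<lambda>w. ((F \<circ> chart_inv c) \<circ> \<phi>) w / (g \<circ> chart_inv d) w) (snd d p)"
    by (rule zorder_cong) simp
  also have "\<dots> = zorder ((F \<circ> chart_inv c) \<circ> \<phi>) (snd d p) - zorder (g \<circ> chart_inv d) (snd d p)"
  proof (rule zorder_divide)
    show "((F \<circ> chart_inv c) \<circ> \<phi>) meromorphic_on {snd d p}"
      unfolding o_def[of "F \<circ> chart_inv c" \<phi>]
      by (rule meromorphic_on_compose[OF mero[folded F_def] \<phi>a]) (simp add: \<phi>p)
    \<comment> \<open>nonvanishing is carried from the chart \<open>c\<close> to the chart \<open>d\<close> through the surface\<close>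
    have "eventually (\<lambda>x. F x \<noteq> 0) (atin (topo X) p)"
      using nz unfolding eventually_atin_chart[OF X c] F_def .
    then have "eventually (\<lambda>x. F (chart_inv c (snd c x)) \<noteq> 0) (atin (topo X) p)"
      using near by eventually_elim (use X cD in auto)
    then have "\<forall>\<^sub>F w in at (snd d p). ((F \<circ> chart_inv c) \<circ> \<phi>) w \<noteq> 0"
      unfolding eventually_atin_chart[OF X d] by (simp add: \<phi>_def)
    then show "\<exists>\<^sub>F w in at (snd d p). ((F \<circ> chart_inv c) \<circ> \<phi>) w \<noteq> 0"
      by (rule eventually_frequently[rotated]) simp
    show "(g \<circ> chart_inv d) meromorphic_on {snd d p}"
      using ga by (rule analytic_on_imp_meromorphic_on)
    have "\<forall>\<^sub>F w in at (snd d p). (g \<circ> chart_inv d) w \<noteq> 0"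
      using gp analytic_at_imp_isCont[OF ga] continuous_at_avoid[of "snd d p" "g \<circ> chart_inv d" 0]
      by (auto simp: eventually_at dist_commute)
    then show "\<exists>\<^sub>F w in at (snd d p). (g \<circ> chart_inv d) w \<noteq> 0"
      by (rule eventually_frequently[rotated]) simp
  qed
  also have "zorder (g \<circ> chart_inv d) (snd d p) = 0" using ga gp by (rule zorder_eq_0I)
  also have "zorder ((F \<circ> chart_inv c) \<circ> \<phi>) (snd d p) = zorder (F \<circ> chart_inv c) (\<phi> (snd d p))"
    by (rule zorder_compose_deriv_nonzero) (use mero nz \<phi>a \<phi>d in \<open>simp_all add: \<phi>p F_def\<close>)
  finally show ?thesis by (simp only: \<phi>p F_def diff_zero)
qed

text \<open>This turns the definite description in \<^const>\<open>section_order\<close> into something computable: one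
  frame of the bundle and one chart suffice. Without the nonvanishing condition the description might
  have no solution, as \<^const>\<open>zorder\<close> is unspecified for functions that vanish identically.\<close>

lemma section_order_eq_zorder:
  assumes X: "riemann_surface X" and L: "holomorphic_line_bundle X L"
    and U: "(U, e) \<in> frames L" "p \<in> U" and c: "c \<in> charts_at X p"
    and s: "eventually (\<lambda>x. s x \<in> fibre L x) (atin (topo X) p)"
    and mero: "(coefficient L e s \<circ> chart_inv c) meromorphic_on {snd c p}"
    and nz: "\<forall>\<^sub>F w in at (snd c p). coefficient L e s (chart_inv c w) \<noteq> 0"
  shows "section_order X L s p = zorder (coefficient L e s \<circ> chart_inv c) (snd c p)"
proof -
  let ?n = "zorder (coefficient L e s \<circ> chart_inv c) (snd c p)"
  have "\<forall>W f. holomorphic_frame_on X L W f \<and> p \<in> W \<longrightarrow>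
      (\<forall>d\<in>charts_at X p. zorder (coefficient L f s \<circ> chart_inv d) (snd d p) = ?n)"
    using zorder_coefficient_frame_chart_independent[OF assms] by blast
  moreover have "n = ?n"
    if "\<forall>W f. holomorphic_frame_on X L W f \<and> p \<in> W \<longrightarrow>
      (\<forall>d\<in>charts_at X p. zorder (coefficient L f s \<circ> chart_inv d) (snd d p) = n)" for n
    using that[rule_format, OF conjI, OF holomorphic_frame_on_frame[OF L U(1)] U(2) c] by simp
  ultimately show ?thesis unfolding section_order_def by (rule the_equality)
qed

section \<open>Coefficients in Hom bundles\<close>

text \<open>As \<open>e\<close> spans the source line, its multiples determine a map completely. Comparing with \<open>t\<close> times
  the induced frame therefore also gives the linearity that membership in the fibre demands.\<close>

lemma hom_bundle_coefficient:
  assumes X: "riemann_surface X"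
    and L: "holomorphic_line_bundle X L" and M: "holomorphic_line_bundle X M"
    and U: "(U, e) \<in> frames L" "p \<in> U" and V: "(V, f) \<in> frames M" "p \<in> V"
    and h: "h = (\<lambda>p. \<lambda>v\<in>fibre L p. vscale M p (THE a. v = vscale L p a (e p)) (f p))"
    and ext: "s p \<in> extensional (fibre L p)"
    and eq: "\<And>a. s p (vscale L p a (e p)) = vscale M p (t * a) (f p)"
  shows "s p \<in> fibre (hom_bundle L M) p" and "coefficient (hom_bundle L M) h s p = t"
proof -
  let ?H = "hom_bundle L M"
  have H: "holomorphic_line_bundle X ?H" by (rule line_bundle_hom_bundle[OF X L M])
  have Uh: "(U \<inter> V, h) \<in> frames ?H" "p \<in> U \<inter> V"
    using U V by (auto simp: hom_bundle_def h)
  have "s p = vscale ?H p t (h p)"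
  proof (rule extensionalityI[OF ext])
    show "vscale ?H p t (h p) \<in> extensional (fibre L p)" by (simp add: hom_bundle_def)
    fix v assume "v \<in> fibre L p"
    then obtain a where v: "v = vscale L p a (e p)" using fibre_expand[OF L U] by blast
    have "vscale ?H p t (h p) v = vscale M p t (vscale M p a (f p))"
      using coefficient_eq(4,5)[OF L U] by (simp add: hom_bundle_def h v)
    then show "s p v = vscale ?H p t (h p) v"
      using eq[of a] holomorphic_line_bundleD(7)[OF M V] by (simp add: v)
  qed
  then show "s p \<in> fibre ?H p" "coefficient ?H h s p = t"
    using coefficient_eq(2,5)[OF H Uh] by simp_all
qed

section \<open>Differentials in coordinates\<close>

text \<open>In coordinates the differential is multiplication by the derivative of the local
  representative. The chain rule is used twice: in the source to replace the chart chosen by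
  \<^const>\<open>differential\<close> by \<open>c\<close>, and in the target to express the component in the chart \<open>b\<close> by the
  one in \<open>d\<close>.\<close>

lemma differential_coordinate_field:
  assumes X: "riemann_surface X" and Y: "riemann_surface Y" and f: "holomorphic_map X Y f"
    and c: "c \<in> charts_at X p" and d: "d \<in> charts_at Y (f p)"
  shows "differential X Y f p (\<lambda>b. a * coordinate_field X c p b) =
         (\<lambda>b. (deriv (local_rep c d f) (snd c p) * a) * coordinate_field Y d (f p) b)"
proof
  fix b
  let ?k = "SOME k. k \<in> charts_at X p"
  have k: "?k \<in> charts_at X p" using c by (rule someI)
  have t: "(\<lambda>b. a * coordinate_field X c p b) \<in> tangent_space X p"
    by (rule tangent_scale[OF coordinate_field_tangent(1)[OF X c]])
  show "differential X Y f p (\<lambda>b. a * coordinate_field X c p b) b =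
        (deriv (local_rep c d f) (snd c p) * a) * coordinate_field Y d (f p) b"
  proof (cases "b \<in> charts_at Y (f p)")
    case True
    have 1: "deriv (local_rep c b f) (snd c p) =
        deriv (local_rep ?k b f) (snd ?k p) * deriv (snd ?k \<circ> chart_inv c) (snd c p)"
      using deriv_local_rep_compose[OF X X Y holomorphic_map_id[OF X] f c, of ?k b] k True by simp
    have 2: "deriv (local_rep c b f) (snd c p) =
        deriv (snd b \<circ> chart_inv d) (snd d (f p)) * deriv (local_rep c d f) (snd c p)"
      using deriv_local_rep_compose[OF X Y Y f holomorphic_map_id[OF Y] c d, of b] True by simp
    have "differential X Y f p (\<lambda>b. a * coordinate_field X c p b) b =
        deriv (local_rep ?k b f) (snd ?k p) * (a * coordinate_field X c p ?k)"
      using t True by (simp add: differential_def Let_def)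
    also have "\<dots> = deriv (local_rep c b f) (snd c p) * a"
      using k 1 by (simp add: coordinate_field_def)
    also have "\<dots> = (deriv (local_rep c d f) (snd c p) * a) * coordinate_field Y d (f p) b"
      using True 2 by (simp add: coordinate_field_def)
    finally show ?thesis .
  next
    case False
    then show ?thesis using t by (simp add: differential_def coordinate_field_def)
  qed
qed

lemma inv_differential_coordinate_field:
  assumes X: "riemann_surface X" and Y: "riemann_surface Y" and f: "holomorphic_map X Y f"
    and c: "c \<in> charts_at X p" and d: "d \<in> charts_at Y (f p)"
    and nz: "deriv (local_rep c d f) (snd c p) \<noteq> 0"
  shows "inv_into (tangent_space X p) (differential X Y f p)
           (\<lambda>b. a * coordinate_field Y d (f p) b) =
         (\<lambda>b. (a / deriv (local_rep c d f) (snd c p)) * coordinate_field X c p b)"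
proof (rule inv_into_f_eq)
  show "inj_on (differential X Y f p) (tangent_space X p)"
  proof (rule inj_onI)
    fix u v assume uv: "u \<in> tangent_space X p" "v \<in> tangent_space X p"
      and eq: "differential X Y f p u = differential X Y f p v"
    have D: "differential X Y f p w d = deriv (local_rep c d f) (snd c p) * w c"
      if "w \<in> tangent_space X p" for w
      using differential_coordinate_field[OF X Y f c d, of "w c"] tangent_expand[OF X c that]
        coordinate_field_tangent(2)[OF Y d] by simp
    have "u c = v c" using D[OF uv(1)] D[OF uv(2)] eq nz by simp
    then show "u = v" using tangent_expand[OF X c uv(1)] tangent_expand[OF X c uv(2)] by simp
  qed
  show "(\<lambda>b. (a / deriv (local_rep c d f) (snd c p)) * coordinate_field X c p b) \<in> tangent_space X p"
    by (rule tangent_scale[OF coordinate_field_tangent(1)[OF X c]])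
  show "differential X Y f p (\<lambda>b. (a / deriv (local_rep c d f) (snd c p)) * coordinate_field X c p b) =
        (\<lambda>b. a * coordinate_field Y d (f p) b)"
    unfolding differential_coordinate_field[OF X Y f c d] using nz by simp
qed

text \<open>The frame \<open>h\<close> is induced by the coordinate fields of \<open>c\<close> and \<open>d\<close>. One frame serves all points
  of \<open>U\<close>, so the coefficient of \<open>Tf\<close> is the derivative as a function and not only a value at one point;
  this is what allows its order to be read off.\<close>

lemma differential_coefficient:
  assumes X: "riemann_surface X" and Y: "riemann_surface Y" and f: "holomorphic_map X Y f"
    and c: "c \<in> atlas X" and d: "d \<in> atlas Y"
  obtains U h where "(U, h) \<in> frames (hom_bundle (tangent_bundle X) (pullback_bundle X f (tangent_bundle Y)))"
    and "U = fst c \<inter> f -` fst d"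
    and "\<And>p. p \<in> U \<Longrightarrow> differential X Y f p \<in>
           fibre (hom_bundle (tangent_bundle X) (pullback_bundle X f (tangent_bundle Y))) p"
    and "\<And>p. p \<in> U \<Longrightarrow>
           coefficient (hom_bundle (tangent_bundle X) (pullback_bundle X f (tangent_bundle Y))) h
             (differential X Y f) p = deriv (local_rep c d f) (snd c p)"
proof -
  let ?L = "tangent_bundle X" and ?M = "pullback_bundle X f (tangent_bundle Y)"
  let ?h = "\<lambda>p. \<lambda>v\<in>fibre ?L p. vscale ?M p (THE a. v = vscale ?L p a (coordinate_field X c p))
      ((coordinate_field Y d \<circ> f) p)"
  note L = line_bundle_tangent_bundle[OF X]
  note M = line_bundle_pullback_bundle[OF X Y f line_bundle_tangent_bundle[OF Y]]
  have Lf: "(fst c, coordinate_field X c) \<in> frames ?L"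
    using c unfolding tangent_bundle_def line_bundle.simps by blast
  have Mf: "(topspace (topo X) \<inter> f -` fst d, coordinate_field Y d \<circ> f) \<in> frames ?M"
    using d unfolding tangent_bundle_def pullback_bundle_def line_bundle.simps by blast
  have U: "fst c \<inter> (topspace (topo X) \<inter> f -` fst d) = fst c \<inter> f -` fst d"
    using chart_dom_subset[OF X c] by auto
  have fr: "(fst c \<inter> f -` fst d, ?h) \<in> frames (hom_bundle ?L ?M)"
    unfolding U[symmetric] using Lf Mf unfolding hom_bundle_def line_bundle.simps by blast
  have "differential X Y f p \<in> fibre (hom_bundle ?L ?M) p \<and>
      coefficient (hom_bundle ?L ?M) ?h (differential X Y f) p = deriv (local_rep c d f) (snd c p)"
    if p: "p \<in> fst c \<inter> f -` fst d" for p
  proof -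
    have cp: "c \<in> charts_at X p" and dp: "d \<in> charts_at Y (f p)"
      using p c d by (auto simp: charts_at_def)
    have p': "p \<in> topspace (topo X) \<inter> f -` fst d" "p \<in> fst c" using p U by auto
    have ext: "differential X Y f p \<in> extensional (fibre ?L p)"
      by (simp add: differential_def tangent_bundle_def)
    have eq: "differential X Y f p (vscale ?L p a (coordinate_field X c p)) =
        vscale ?M p (deriv (local_rep c d f) (snd c p) * a) ((coordinate_field Y d \<circ> f) p)" for a
      using differential_coordinate_field[OF X Y f cp dp, of a]
      by (simp add: tangent_bundle_def pullback_bundle_def)
    show ?thesis
      using hom_bundle_coefficient[where s = "differential X Y f", OF X L M Lf p'(2) Mf p'(1) refl ext eq]
      by blast
  qed
  with fr show ?thesis by (intro that[OF _ refl]) blast+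
qed

section \<open>The ramification divisor\<close>

text \<open>The hypotheses under which the ramification divisor describes the zeros of the differential:
  on a connected surface, nonconstancy excludes that the differential vanishes identically anywhere.\<close>

locale nonconstant_map =
  fixes X :: "'a surface" and f :: "'a \<Rightarrow> complex option"
  assumes X: "riemann_surface X"
    and connected: "connected_space (topo X)"
    and holomorphic: "holomorphic_map X P1 f"
    and nonconstant: "\<not> (\<exists>y. \<forall>p\<in>topspace (topo X). f p = y)"
begin

lemma target_chart:
  assumes "p \<in> topspace (topo X)"
  obtains d where "d \<in> charts_at P1 (f p)"
proof -
  have "f p \<in> topspace (topo P1)"
    using holomorphic assms by (auto simp: holomorphic_map_def continuous_map_def)
  then show ?thesis using charts_at_nonempty[OF riemann_surface_P1] that by blast
qed

lemma ramification_divisor_eq_zorder: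
  assumes c: "c \<in> charts_at X p" and d: "d \<in> charts_at P1 (f p)"
  shows "ramification_divisor X f p = zorder (deriv (local_rep c d f)) (snd c p)"
proof -
  note cD = charts_atD[OF c] and dD = charts_atD[OF d]
  note F = local_rep_holomorphic[OF X riemann_surface_P1 holomorphic c d]
  have pX: "p \<in> topspace (topo X)" using chart_dom_subset[OF X cD(1)] cD(2) by auto
  let ?H = "hom_bundle (tangent_bundle X) (pullback_bundle X f (tangent_bundle P1))"
  let ?s = "differential X P1 f"
  have H: "holomorphic_line_bundle X ?H"
    by (intro line_bundle_hom_bundle line_bundle_pullback_bundle[OF X riemann_surface_P1]
        line_bundle_tangent_bundle X riemann_surface_P1 holomorphic)
  obtain U h where Uh: "(U, h) \<in> frames ?H" and U: "U = fst c \<inter> f -` fst d"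
    and fib: "\<And>p. p \<in> U \<Longrightarrow> ?s p \<in> fibre ?H p"
    and coeff: "\<And>p. p \<in> U \<Longrightarrow> coefficient ?H h ?s p = deriv (local_rep c d f) (snd c p)"
    using differential_coefficient[OF X riemann_surface_P1 holomorphic cD(1) dD(1)] by blast
  have pU: "p \<in> U" using cD dD by (simp add: U)
  have "\<forall>\<^sub>F w in at (snd c p). w \<in> snd c ` U"
    using eventually_nhds_in_open[OF F(1,2)] unfolding U by (simp add: eventually_at_filter eventually_mono)
  then have ev: "\<forall>\<^sub>F w in at (snd c p). (coefficient ?H h ?s \<circ> chart_inv c) w = deriv (local_rep c d f) w"
    by eventually_elim (use coeff X cD in \<open>auto simp: U\<close>)
  have an: "deriv (local_rep c d f) analytic_on {snd c p}" using F(4) by (rule analytic_deriv)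
  have nz: "\<forall>\<^sub>F w in at (snd c p). deriv (local_rep c d f) w \<noteq> 0"
    by (rule deriv_local_rep_eventually_nonzero[OF X riemann_surface_P1 holomorphic connected nonconstant c d])
  have "section_order X ?H ?s p = zorder (coefficient ?H h ?s \<circ> chart_inv c) (snd c p)"
  proof (rule section_order_eq_zorder[OF X H Uh pU c])
    show "eventually (\<lambda>x. ?s x \<in> fibre ?H x) (atin (topo X) p)"
      unfolding eventually_atin using holomorphic_line_bundleD(2)[OF H Uh] pU fib by blast
    show "(coefficient ?H h ?s \<circ> chart_inv c) meromorphic_on {snd c p}"
      using meromorphic_on_cong[of "{snd c p}" "coefficient ?H h ?s \<circ> chart_inv c" "deriv (local_rep c d f)" "{snd c p}"]
        ev analytic_on_imp_meromorphic_on[OF an] by simp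
    show "\<forall>\<^sub>F w in at (snd c p). coefficient ?H h ?s (chart_inv c w) \<noteq> 0"
      using ev nz by eventually_elim simp
  qed
  also have "\<dots> = zorder (deriv (local_rep c d f)) (snd c p)" using ev by (rule zorder_cong) simp
  finally show ?thesis using pX by (simp add: ramification_divisor_def Div_def)
qed

text \<open>A holomorphic function that is not identically zero has order 0 exactly where it does not
  vanish. Hence the support is the set of points where \<open>Tf\<close> is not invertible.\<close>

lemma mem_supp_ramification_divisor_iff:
  assumes c: "c \<in> charts_at X p" and d: "d \<in> charts_at P1 (f p)"
  shows "p \<in> supp (ramification_divisor X f) \<longleftrightarrow> deriv (local_rep c d f) (snd c p) = 0"
proof -
  have "\<exists>\<^sub>F w in at (snd c p). deriv (local_rep c d f) w \<noteq> 0"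
    using deriv_local_rep_eventually_nonzero[OF X riemann_surface_P1 holomorphic connected nonconstant c d]
    by (rule eventually_frequently[rotated]) simp
  moreover have "deriv (local_rep c d f) analytic_on {snd c p}"
    using local_rep_holomorphic(4)[OF X riemann_surface_P1 holomorphic c d] by (rule analytic_deriv)
  ultimately show ?thesis
    using zorder_eq_0_iff ramification_divisor_eq_zorder[OF c d] by (auto simp: supp_def)
qed

lemma supp_ramification_divisor_subset: "supp (ramification_divisor X f) \<subseteq> topspace (topo X)"
  by (auto simp: supp_def ramification_divisor_def Div_def split: if_splits)

lemma eventually_unramified:
  assumes p: "p \<in> topspace (topo X)"
  shows "eventually (\<lambda>x. x \<notin> supp (ramification_divisor X f)) (atin (topo X) p)"
proof -
  obtain c where c: "c \<in> charts_at X p" using charts_at_nonempty[OF X p] by blast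
  obtain d where d: "d \<in> charts_at P1 (f p)" using target_chart[OF p] by blast
  note cD = charts_atD[OF c] and dD = charts_atD[OF d]
  have "\<forall>\<^sub>F w in at (snd c p). w \<in> snd c ` (fst c \<inter> f -` fst d)"
    using eventually_nhds_in_open[OF local_rep_holomorphic(1,2)[OF X riemann_surface_P1 holomorphic c d]]
    by (simp add: eventually_at_filter eventually_mono)
  moreover have "\<forall>\<^sub>F w in at (snd c p). deriv (local_rep c d f) w \<noteq> 0"
    by (rule deriv_local_rep_eventually_nonzero[OF X riemann_surface_P1 holomorphic connected nonconstant c d])
  ultimately have "\<forall>\<^sub>F w in at (snd c p). chart_inv c w \<notin> supp (ramification_divisor X f)"
  proof eventually_elim
    case (elim w)
    then obtain x where x: "x \<in> fst c" "f x \<in> fst d" "w = snd c x" by auto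
    then have "c \<in> charts_at X x" "d \<in> charts_at P1 (f x)" using cD dD by (auto simp: charts_at_def)
    then show ?case using elim x X cD mem_supp_ramification_divisor_iff by auto
  qed
  then show ?thesis unfolding eventually_atin_chart[OF X c] .
qed

lemma supp_ramification_divisor_derived:
  "topo X derived_set_of supp (ramification_divisor X f) = {}"
proof -
  let ?S = "supp (ramification_divisor X f)"
  have "p \<notin> topo X derived_set_of ?S" for p
  proof
    assume p: "p \<in> topo X derived_set_of ?S"
    then have "p \<in> topspace (topo X)" by (simp add: in_derived_set_of)
    then obtain V where "openin (topo X) V" "p \<in> V" "\<forall>x\<in>V - {p}. x \<notin> ?S"
      using eventually_unramified by (auto simp: eventually_atin)
    then show False using p by (auto simp: in_derived_set_of)
  qed
  then show ?thesis by blast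
qed

lemma is_divisor_ramification_divisor:
  assumes "compact_space (topo X)"
  shows "is_divisor X (ramification_divisor X f)"
  unfolding is_divisor_def
  using compact_space_imp_Bolzano_Weierstrass[OF assms] supp_ramification_divisor_derived
    supp_ramification_divisor_subset by blast

end

section \<open>The relative differential\<close>

text \<open>In the comments below, \<open>q'\<close> and \<open>z'\<close> denote the derivatives of local representatives of
  \<open>q\<close> and \<open>z\<close>.\<close>

locale two_nonconstant_maps = q: nonconstant_map X q + z: nonconstant_map X z
  for X :: "'a surface" and q z :: "'a \<Rightarrow> complex option"
begin

abbreviation H where "H \<equiv> relative_hom_bundle X q z"
abbreviation Z where "Z \<equiv> relative_differential X q z"
abbreviation ramified where
  "ramified \<equiv> supp (ramification_divisor X q) \<union> supp (ramification_divisor X z)"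

lemma line_bundle_H: "holomorphic_line_bundle X H"
  by (rule line_bundle_relative_hom_bundle[OF q.X q.holomorphic z.holomorphic])

lemma eventually_not_ramified:
  "p \<in> topspace (topo X) \<Longrightarrow> eventually (\<lambda>x. x \<notin> ramified) (atin (topo X) p)"
  using eventually_conj[OF q.eventually_unramified z.eventually_unramified] by simp

lemma frames_H:
  assumes "(U, h) \<in> frames H"
  obtains d d' where "d \<in> atlas P1" "d' \<in> atlas P1"
    and "U = topspace (topo X) \<inter> q -` fst d \<inter> (topspace (topo X) \<inter> z -` fst d')"
    and "h = (\<lambda>p. \<lambda>v\<in>fibre (pullback_bundle X q (tangent_bundle P1)) p.
            vscale (pullback_bundle X z (tangent_bundle P1)) p
              (THE a. v = vscale (pullback_bundle X q (tangent_bundle P1)) p a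
                 ((coordinate_field P1 d \<circ> q) p)) ((coordinate_field P1 d' \<circ> z) p))"
  using assms unfolding relative_hom_bundle_def hom_bundle_def tangent_bundle_def pullback_bundle_def
    line_bundle.simps by blast

lemma frames_H_exist:
  assumes "p \<in> topspace (topo X)"
  obtains U h where "(U, h) \<in> frames H" "p \<in> U"
proof -
  have "p \<in> (\<Union>k\<in>frames H. fst k)" using assms holomorphic_line_bundleD(1)[OF line_bundle_H] by simp
  then show ?thesis using that by (metis UN_E prod.collapse)
qed

text \<open>In terms of the coordinate fields, \<open>Tq\<close> is multiplication by \<open>q'\<close> and \<open>Tz\<close> is multiplication
  by \<open>z'\<close>, where both derivatives are taken in the same chart \<open>c\<close> of \<open>X\<close>. So \<open>Tz \<circ> (Tq)\<^sup>-\<^sup>1\<close> is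
  multiplication by \<open>z' / q'\<close>.\<close>

lemma relative_differential_coordinates:
  assumes Uh: "(U, h) \<in> frames H"
  obtains d d' where "d \<in> atlas P1" "d' \<in> atlas P1"
    and "\<And>p. p \<in> U \<Longrightarrow> p \<in> topspace (topo X) \<and> q p \<in> fst d \<and> z p \<in> fst d'"
    and "\<And>p. p \<in> U \<Longrightarrow> p \<notin> ramified \<Longrightarrow> Z p \<in> fibre H p"
    and "\<And>c p. p \<in> U \<Longrightarrow> p \<notin> ramified \<Longrightarrow> c \<in> charts_at X p \<Longrightarrow>
           coefficient H h Z p = deriv (local_rep c d' z) (snd c p) / deriv (local_rep c d q) (snd c p)"
proof -
  let ?L = "pullback_bundle X q (tangent_bundle P1)" and ?M = "pullback_bundle X z (tangent_bundle P1)"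
  note P = riemann_surface_P1
  note L = line_bundle_pullback_bundle[OF q.X P q.holomorphic line_bundle_tangent_bundle[OF P]]
  note M = line_bundle_pullback_bundle[OF q.X P z.holomorphic line_bundle_tangent_bundle[OF P]]
  obtain d d' where d: "d \<in> atlas P1" and d': "d' \<in> atlas P1"
    and U: "U = topspace (topo X) \<inter> q -` fst d \<inter> (topspace (topo X) \<inter> z -` fst d')"
    and h: "h = (\<lambda>p. \<lambda>v\<in>fibre ?L p. vscale ?M p
              (THE a. v = vscale ?L p a ((coordinate_field P1 d \<circ> q) p)) ((coordinate_field P1 d' \<circ> z) p))"
    using frames_H[OF Uh] by blast
  have Lf: "(topspace (topo X) \<inter> q -` fst d, coordinate_field P1 d \<circ> q) \<in> frames ?L"
    using d unfolding tangent_bundle_def pullback_bundle_def line_bundle.simps by blast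
  have Mf: "(topspace (topo X) \<inter> z -` fst d', coordinate_field P1 d' \<circ> z) \<in> frames ?M"
    using d' unfolding tangent_bundle_def pullback_bundle_def line_bundle.simps by blast
  have main: "Z p \<in> fibre H p \<and> coefficient H h Z p =
      deriv (local_rep c d' z) (snd c p) / deriv (local_rep c d q) (snd c p)"
    if p: "p \<in> U" "p \<notin> ramified" and c: "c \<in> charts_at X p" for c p
  proof -
    let ?q' = "deriv (local_rep c d q) (snd c p)" and ?z' = "deriv (local_rep c d' z) (snd c p)"
    have dp: "d \<in> charts_at P1 (q p)" "d' \<in> charts_at P1 (z p)"
      using p(1) d d' by (auto simp: charts_at_def U)
    have pX: "p \<in> topspace (topo X)" and p': "p \<in> topspace (topo X) \<inter> q -` fst d"
        "p \<in> topspace (topo X) \<inter> z -` fst d'"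
      using p(1) by (auto simp: U)
    have q0: "?q' \<noteq> 0" using p(2) q.mem_supp_ramification_divisor_iff[OF c dp(1)] by simp
    have Zp: "Z p = (\<lambda>w\<in>tangent_space P1 (q p).
        differential X P1 z p (inv_into (tangent_space X p) (differential X P1 q p) w))"
      using pX p(2) by (simp add: relative_differential_def)
    have ext: "Z p \<in> extensional (fibre ?L p)"
      by (simp add: Zp tangent_bundle_def pullback_bundle_def)
    have eq: "Z p (vscale ?L p a ((coordinate_field P1 d \<circ> q) p)) =
        vscale ?M p (?z' / ?q' * a) ((coordinate_field P1 d' \<circ> z) p)" for a
    proof -
      have "(\<lambda>b. a * coordinate_field P1 d (q p) b) \<in> tangent_space P1 (q p)"
        by (rule tangent_scale[OF coordinate_field_tangent(1)[OF P dp(1)]])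
      then have "Z p (\<lambda>b. a * coordinate_field P1 d (q p) b) =
          differential X P1 z p (\<lambda>b. (a / ?q') * coordinate_field X c p b)"
        unfolding Zp using inv_differential_coordinate_field[OF q.X P q.holomorphic c dp(1) q0, of a] by simp
      also have "\<dots> = (\<lambda>b. (?z' * (a / ?q')) * coordinate_field P1 d' (z p) b)"
        by (rule differential_coordinate_field[OF q.X P z.holomorphic c dp(2)])
      finally show ?thesis by (simp add: tangent_bundle_def pullback_bundle_def)
    qed
    show ?thesis
      using hom_bundle_coefficient[where s = Z, OF q.X L M Lf p'(1) Mf p'(2) h ext eq]
      unfolding relative_hom_bundle_def by blast
  qed
  have fib: "Z p \<in> fibre H p" if "p \<in> U" "p \<notin> ramified" for p
  proof -
    have "p \<in> topspace (topo X)" using that(1) by (simp add: U)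
    then obtain c where "c \<in> charts_at X p" using charts_at_nonempty[OF q.X] by blast
    then show ?thesis using main that by blast
  qed
  show ?thesis
    by (rule that[OF d d']) (use main fib in \<open>auto simp: U\<close>)
qed

lemma relative_differential_fibre:
  assumes "p \<in> topspace (topo X)" "p \<notin> ramified"
  shows "Z p \<in> fibre H p"
  using frames_H_exist[OF assms(1)] relative_differential_coordinates assms(2) by metis

text \<open>Off the isolated ramification points the coefficient of \<open>Z\<close> is the quotient \<open>z' / q'\<close> of
  holomorphic functions, neither of which vanishes identically. Everything about the germ of \<open>Z\<close> at
  \<open>p\<close> follows: it is meromorphic, and its order is the difference of the orders of \<open>z'\<close> and \<open>q'\<close>, that
  is, of the multiplicities of \<open>p\<close> in the two ramification divisors.\<close>

lemma relative_differential_local: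
  assumes Uh: "(U, h) \<in> frames H" and p: "p \<in> U" and c: "c \<in> charts_at X p"
  shows "(coefficient H h Z \<circ> chart_inv c) meromorphic_on {snd c p}"
    and "\<forall>\<^sub>F w in at (snd c p). coefficient H h Z (chart_inv c w) \<noteq> 0"
    and "zorder (coefficient H h Z \<circ> chart_inv c) (snd c p) =
           ramification_divisor X z p - ramification_divisor X q p"
    and "p \<notin> ramified \<Longrightarrow> (coefficient H h Z \<circ> chart_inv c) analytic_on {snd c p}"
proof -
  note P = riemann_surface_P1 and cD = charts_atD[OF c]
  obtain d d' where d: "d \<in> atlas P1" "d' \<in> atlas P1"
    and U: "\<And>p. p \<in> U \<Longrightarrow> p \<in> topspace (topo X) \<and> q p \<in> fst d \<and> z p \<in> fst d'"
    and coeff: "\<And>c p. p \<in> U \<Longrightarrow> p \<notin> ramified \<Longrightarrow> c \<in> charts_at X p \<Longrightarrow>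
           coefficient H h Z p = deriv (local_rep c d' z) (snd c p) / deriv (local_rep c d q) (snd c p)"
    using relative_differential_coordinates[OF Uh] by metis
  let ?f = "coefficient H h Z \<circ> chart_inv c"
  let ?q = "deriv (local_rep c d q)" and ?z = "deriv (local_rep c d' z)"
  have oU: "openin (topo X) U" by (rule holomorphic_line_bundleD(2)[OF line_bundle_H Uh])
  have dp: "d \<in> charts_at P1 (q p)" "d' \<in> charts_at P1 (z p)"
    using U[OF p] d by (auto simp: charts_at_def)
  have an: "?q analytic_on {snd c p}" "?z analytic_on {snd c p}"
    using local_rep_holomorphic(4)[OF q.X P q.holomorphic c dp(1)]
      local_rep_holomorphic(4)[OF q.X P z.holomorphic c dp(2)] by (auto intro: analytic_deriv)
  have mero: "?q meromorphic_on {snd c p}" "?z meromorphic_on {snd c p}"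
    using an by (auto intro: analytic_on_imp_meromorphic_on)
  have nz: "\<forall>\<^sub>F w in at (snd c p). ?q w \<noteq> 0" "\<forall>\<^sub>F w in at (snd c p). ?z w \<noteq> 0"
    using deriv_local_rep_eventually_nonzero[OF q.X P q.holomorphic q.connected q.nonconstant c dp(1)]
      deriv_local_rep_eventually_nonzero[OF q.X P z.holomorphic q.connected z.nonconstant c dp(2)] by auto
  have quot: "?f (snd c x) = ?z (snd c x) / ?q (snd c x)"
    if "x \<in> U \<inter> fst c" "x \<notin> ramified" for x
    using coeff[of x c] that cD(1) q.X by (auto simp: charts_at_def)
  have oc: "openin (topo X) (U \<inter> fst c)" using oU openin_chart_dom[OF q.X cD(1)] by auto
  then have "eventually (\<lambda>x. x \<in> U \<inter> fst c) (atin (topo X) p)"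
    unfolding eventually_atin using p cD by blast
  then have "eventually (\<lambda>x. ?f (snd c x) = ?z (snd c x) / ?q (snd c x) \<and> x \<in> fst c) (atin (topo X) p)"
    using eventually_not_ramified[of p] U[OF p] quot by (auto elim: eventually_elim2)
  moreover have "\<forall>\<^sub>F w in at (snd c p). w \<in> snd c ` fst c"
    using holo_trans(2)[OF q.X cD(1) cD(1)] cD(2)
    by (simp add: eventually_at_topological) blast
  ultimately have ev: "\<forall>\<^sub>F w in at (snd c p). ?f w = ?z w / ?q w"
    unfolding eventually_atin_chart[OF q.X c]
    by eventually_elim (use q.X cD in auto)
  show "?f meromorphic_on {snd c p}"
    using meromorphic_on_cong[of "{snd c p}" ?f "\<lambda>w. ?z w / ?q w" "{snd c p}"] ev
      meromorphic_on_divide[OF mero(2,1)] by simp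
  show "\<forall>\<^sub>F w in at (snd c p). coefficient H h Z (chart_inv c w) \<noteq> 0"
    using ev nz by eventually_elim simp
  have "zorder ?f (snd c p) = zorder (\<lambda>w. ?z w / ?q w) (snd c p)"
    using ev by (rule zorder_cong) simp
  also have "\<dots> = zorder ?z (snd c p) - zorder ?q (snd c p)"
    using nz by (intro zorder_divide mero) (auto intro: eventually_frequently[rotated])
  finally show "zorder ?f (snd c p) = ramification_divisor X z p - ramification_divisor X q p"
    by (simp add: q.ramification_divisor_eq_zorder[OF c dp(1)] z.ramification_divisor_eq_zorder[OF c dp(2)])
  show "?f analytic_on {snd c p}" if np: "p \<notin> ramified"
  proof -
    have q0: "?q (snd c p) \<noteq> 0" using np q.mem_supp_ramification_divisor_iff[OF c dp(1)] by simp
    have "(\<lambda>w. ?z w / ?q w) analytic_on {snd c p}" using an q0 by (intro analytic_on_divide) auto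
    moreover have "?f (snd c p) = ?z (snd c p) / ?q (snd c p)" by (rule quot) (use p cD np in auto)
    ultimately show ?thesis
      using ev by (subst analytic_at_cong[where g = "\<lambda>w. ?z w / ?q w"]) (auto simp: eventually_nhds_conv_at)
  qed
qed

lemma Div_relative_differential:
  "Div X H Z = ramification_divisor X z - ramification_divisor X q"
proof
  fix p
  show "Div X H Z p = (ramification_divisor X z - ramification_divisor X q) p"
  proof (cases "p \<in> topspace (topo X)")
    case True
    obtain U h where Uh: "(U, h) \<in> frames H" "p \<in> U" using frames_H_exist[OF True] by blast
    obtain c where c: "c \<in> charts_at X p" using charts_at_nonempty[OF q.X True] by blast
    have "eventually (\<lambda>x. x \<in> topspace (topo X)) (atin (topo X) p)"
      unfolding eventually_atin using openin_topspace True by blast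
    then have "eventually (\<lambda>x. Z x \<in> fibre H x) (atin (topo X) p)"
      using eventually_not_ramified[OF True] by eventually_elim (rule relative_differential_fibre)
    then show ?thesis
      using section_order_eq_zorder[OF q.X line_bundle_H Uh c] relative_differential_local[OF Uh c] True
      by (simp add: Div_def)
  qed (simp add: Div_def ramification_divisor_def)
qed

lemma meromorphic_section_relative_differential: "meromorphic_section X H Z"
  unfolding meromorphic_section_def
proof (intro conjI exI[of _ ramified])
  show sub: "ramified \<subseteq> topspace (topo X)"
    using q.supp_ramification_divisor_subset z.supp_ramification_divisor_subset by blast
  show "topo X derived_set_of ramified = {}"
    using q.supp_ramification_divisor_derived z.supp_ramification_divisor_derived
    by (simp add: derived_set_of_Un)
  have "holomorphic_fun_on X (U \<inter> (topspace (topo X) - ramified)) (coefficient H h Z)"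
    if Uh: "(U, h) \<in> frames H" for U h
    unfolding holomorphic_fun_on_def
  proof
    fix b assume b: "b \<in> atlas X"
    have "(coefficient H h Z \<circ> chart_inv b) analytic_on {snd b p}"
      if "p \<in> fst b \<inter> (U \<inter> (topspace (topo X) - ramified))" for p
      using that b by (intro relative_differential_local(4)[OF Uh]) (auto simp: charts_at_def)
    then show "(coefficient H h Z \<circ> chart_inv b) holomorphic_on
        snd b ` (fst b \<inter> (U \<inter> (topspace (topo X) - ramified)))"
      by (intro analytic_imp_holomorphic) (subst analytic_on_analytic_at, blast)
  qed
  then show "holomorphic_section_on X H (topspace (topo X) - ramified) Z"
    using relative_differential_fibre by (auto simp: holomorphic_section_on_def)
  have "meromorphic_fun_on X U (coefficient H h Z)" if Uh: "(U, h) \<in> frames H" for U h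
    unfolding meromorphic_fun_on_def
  proof
    fix b assume b: "b \<in> atlas X"
    have "(coefficient H h Z \<circ> chart_inv b) meromorphic_on {snd b p}" if "p \<in> fst b \<inter> U" for p
      using that b by (intro relative_differential_local(1)[OF Uh]) (auto simp: charts_at_def)
    then show "(coefficient H h Z \<circ> chart_inv b) meromorphic_on snd b ` (fst b \<inter> U)"
      by (subst meromorphic_on_meromorphic_at) blast
  qed
  then show "\<forall>(U, e)\<in>frames H. meromorphic_fun_on X U (coefficient H e Z)" by blast
qed

end

theorem proposition4p1:
  fixes X :: "'a surface" and q z :: "'a \<Rightarrow> complex option"
  assumes "riemann_surface X"
    and "compact_space (topo X)" and "connected_space (topo X)"
    and "holomorphic_map X P1 q" and "holomorphic_map X P1 z"
    and "\<not> (\<exists>y. \<forall>p\<in>topspace (topo X). q p = y)"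
    and "\<not> (\<exists>y. \<forall>p\<in>topspace (topo X). z p = y)"
  shows "is_divisor X (ramification_divisor X q) \<and>
         is_divisor X (ramification_divisor X z) \<and>
         meromorphic_section X (relative_hom_bundle X q z) (relative_differential X q z) \<and>
         Div X (relative_hom_bundle X q z) (relative_differential X q z) =
           ramification_divisor X z - ramification_divisor X q"
proof -
  interpret two_nonconstant_maps X q z
    using assms by unfold_locales
  show ?thesis
    using q.is_divisor_ramification_divisor z.is_divisor_ramification_divisor
      meromorphic_section_relative_differential Div_relative_differential assms(2) by blast
qed

end
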